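(* Let $1\leq p< \infty$ and $w\in A_p$. There are constants $C_1,C_2>0$ such that for every $a\in\mathbb{R}^n$ and $r>0$: if $1<p<\infty$, $$\|Mf\|_{L^{p,w}(B(a,r))} \leq C_1\, w(B(a,r))^\frac1p \int_{r}^\infty w(B(a,s))^{-\frac1p} \|f\|_{L^{p,w}(B(a,s))} \frac{ds}{s}\quad\text{for all } f\in L_{loc}^{p,w},$$ and $$\|Mf\|_{WL^{1,w}(B(a,r))} \leq C_2\, w(B(a,r)) \int_{r}^\infty w(B(a,s))^{-1} \|f\|_{L^{1,w}(B(a,s))} \frac{ds}{s}\quad\text{for all } f\in L_{loc}^{1,w}.$$
   Context: $M$ is the Hardy–Littlewood maximal operator $Mf(x)=\sup_{r>0}\frac{1}{|B(x,r)|}\int_{B(x,r)}|f(y)|\,dy$. $B(a,r)$ is the open ball, $w(E)=\int_E w$. For $1<p<\infty$, $A_p$ is the set of weights $w$ (nonnegative locally integrable, positive a.e.) with $\left(\frac{1}{|B|}\int_B w\right)\left(\frac{1}{|B|}\int_B w^{-\frac{1}{p-1}}\right)^{p-1}\le C$ for all balls $B$; $A_1$ is the set of weights with $\frac{1}{|B|}\int_B w\cdot\|w^{-1}\|_{L^\infty(B)}\le C$ for all balls $B$. $\|f\|_{L^{p,w}(\Omega)}=\left(\int_\Omega |f|^p w\right)^{1/p}$, $\|f\|_{WL^{p,w}(\Omega)}=\sup_{\gamma>0}\gamma\, w(\{x\in\Omega:|f(x)|>\gamma\})^{1/p}$, and $L^{p,w}_{loc}$ is the set of measurable $f$ with $\|f\chi_B\|_{L^{p,w}}<\infty$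 for every ball $B$.
   Formalization: The second (weak-type) inequality is stated only for p = 1, that is, for w in A_1; for w in A_p with p > 1 it can fail, e.g. n = 1, p = 2, w = |x|^{1/2}, f = |x|^{-1} on (-1,1). *)

theory Defs
  imports "HOL-Analysis.Analysis" "HOL-Probability.Essential_Supremum"
begin

definition enn_powr :: "ennreal \<Rightarrow> real \<Rightarrow> ennreal" where
  "enn_powr x q = (if x = \<infinity> then \<infinity> else ennreal (enn2real x powr q))"

definition maximal_fun :: "('a::euclidean_space \<Rightarrow> real) \<Rightarrow> 'a \<Rightarrow> ennreal" where
  "maximal_fun f x = (SUP r\<in>{0<..}. (\<integral>\<^sup>+ y\<in>ball x r. ennreal \<bar>f y\<bar> \<partial>lebesgue) / emeasure lebesgue (ball x r))"

definition avg :: "('a::euclidean_space \<Rightarrow> real) \<Rightarrow> 'a set \<Rightarrow> ennreal" where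
  "avg g B = (\<integral>\<^sup>+ y\<in>B. ennreal (g y) \<partial>lebesgue) / emeasure lebesgue B"

definition weight :: "('a::euclidean_space \<Rightarrow> real) \<Rightarrow> bool" where
  "weight w \<longleftrightarrow> w \<in> borel_measurable lebesgue \<and> (\<forall>x. 0 \<le> w x)
     \<and> (AE x in lebesgue. 0 < w x) \<and> (\<forall>x r. set_integrable lebesgue (ball x r) w)"

definition Ap_weight :: "real \<Rightarrow> ('a::euclidean_space \<Rightarrow> real) \<Rightarrow> bool" where
  "Ap_weight p w \<longleftrightarrow> weight w \<and>
     (if p = 1 then
        (\<exists>C::real. \<forall>x r. r > 0 \<longrightarrow>
           avg w (ball x r) * esssup (restrict_space lebesgue (ball x r)) (\<lambda>y. ennreal (inverse (w y)))
             \<le> ennreal C)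
      else
        (\<exists>C::real. \<forall>x r. r > 0 \<longrightarrow>
           avg w (ball x r) * enn_powr (avg (\<lambda>y. w y powr (- 1 / (p - 1))) (ball x r)) (p - 1)
             \<le> ennreal C))"

definition wmeas :: "('a::euclidean_space \<Rightarrow> real) \<Rightarrow> 'a set \<Rightarrow> ennreal" where
  "wmeas w E = (\<integral>\<^sup>+ x\<in>E. ennreal (w x) \<partial>lebesgue)"

definition Lpw_norm :: "real \<Rightarrow> ('a::euclidean_space \<Rightarrow> real) \<Rightarrow> 'a set \<Rightarrow> ('a \<Rightarrow> ennreal) \<Rightarrow> ennreal" where
  "Lpw_norm p w \<Omega> g = enn_powr (\<integral>\<^sup>+ x\<in>\<Omega>. enn_powr (g x) p * ennreal (w x) \<partial>lebesgue) (1 / p)"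

definition WLpw_norm :: "real \<Rightarrow> ('a::euclidean_space \<Rightarrow> real) \<Rightarrow> 'a set \<Rightarrow> ('a \<Rightarrow> ennreal) \<Rightarrow> ennreal" where
  "WLpw_norm p w \<Omega> g = (SUP \<gamma>\<in>{0::real<..}. ennreal \<gamma> * enn_powr (wmeas w {x\<in>\<Omega>. g x > ennreal \<gamma>}) (1 / p))"

definition Lpw_loc :: "real \<Rightarrow> ('a::euclidean_space \<Rightarrow> real) \<Rightarrow> ('a \<Rightarrow> real) set" where
  "Lpw_loc p w = {f. f \<in> borel_measurable lebesgue \<and>
     (\<forall>x r. Lpw_norm p w (ball x r) (\<lambda>y. ennreal \<bar>f y\<bar>) < \<infinity>)}"

end

theory Submission
  imports Defs
begin

text \<open>
For \<open>x \<in> B(a,r)\<close>, balls \<open>B(x,t)\<close> with \<open>t < r\<close> stay inside \<open>B(a,2r)\<close>, while for \<open>t \<ge> r\<close> they lie in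
\<open>B(a,2t)\<close> and have comparable volume. The large balls contribute at most a constant multiple of
\<open>w(B(a,2t))^(-1/p) \<parallel>f\<parallel>_(B(a,2t))\<close> by the $A_p$ condition, and by doubling this is controlled by the part of
the integral over \<open>[2t,4t]\<close>. The small balls only see \<open>f\<close> on \<open>B(a,2r)\<close>, where the weighted maximal
theorem applies, and \<open>\<parallel>f\<parallel>_(B(a,2r))\<close> is controlled by the part of the integral over \<open>[2r,4r]\<close>.

For \<open>p = 1\<close> the weighted maximal theorem is a Vitali covering argument. For \<open>p > 1\<close> it is proved by Lerner's method,
without reverse Hoelder inequalities: with \<open>\<sigma> = w^(-1/(p-1))\<close>, both \<open>w\<close> and \<open>\<sigma>\<close> are doubling and
\<open>(M f)^(p-1) \<le> C M_w ((M_\<sigma> (f/\<sigma>))^(p-1) / w)\<close> pointwise, so two applications of the maximal theorem for the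
doubling measures \<open>w dx\<close> and \<open>\<sigma> dx\<close> suffice.
\<close>

section \<open>Powers and layer-cake integrals in the extended nonnegative reals\<close>

lemma ennreal_divide_mult_cancel: "0 < m \<Longrightarrow> m < top \<Longrightarrow> c / m * m = (c::ennreal)"
  by (metis ennreal_times_divide ennreal_mult_divide_eq mult.commute less_top not_gr_zero)

text \<open>Countable subadditivity over an arbitrary countable index set, the shape in which a
  Vitali subfamily arrives. The indicator of the union is at most the sum of the indicators, and sum
  and integral are then exchanged.\<close>

lemma emeasure_countable_UN_le:
  assumes I: "countable I" and A [measurable]: "\<And>i. i \<in> I \<Longrightarrow> A i \<in> sets M"
  shows "emeasure M (\<Union>i\<in>I. A i) \<le> (\<integral>\<^sup>+i. emeasure M (A i) \<partial>count_space I)"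
proof -
  have "emeasure M (\<Union>i\<in>I. A i) = (\<integral>\<^sup>+x. indicator (\<Union>i\<in>I. A i) x \<partial>M)"
    using assms by (intro nn_integral_indicator[symmetric] sets.countable_UN') auto
  also have "\<dots> \<le> (\<integral>\<^sup>+x. \<integral>\<^sup>+i. indicator (A i) x \<partial>count_space I \<partial>M)"
  proof (intro nn_integral_mono)
    fix x
    show "indicator (\<Union>i\<in>I. A i) x \<le> (\<integral>\<^sup>+i. indicator (A i) x \<partial>count_space I :: ennreal)"
    proof (cases "x \<in> (\<Union>i\<in>I. A i)")
      case True
      then obtain i where "i \<in> I" "x \<in> A i" by auto
      then show ?thesis
        using nn_integral_ge_point[of i I "\<lambda>i. indicator (A i) x"] by (simp add: indicator_def)
    qed simp
  qed
  also have "\<dots> = (\<integral>\<^sup>+i. \<integral>\<^sup>+x. indicator (A i) x \<partial>M \<partial>count_space I)"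
    using I by (intro nn_integral_count_space_nn_integral) auto
  also have "\<dots> = (\<integral>\<^sup>+i. emeasure M (A i) \<partial>count_space I)"
    by (intro nn_integral_cong) auto
  finally show ?thesis .
qed

section \<open>Algebra of real powers on \<open>ennreal\<close>\<close>

lemma enn_powr_top [simp]: "enn_powr top q = top"
  by (simp add: enn_powr_def infinity_ennreal_def)

lemma enn_powr_ennreal: "0 \<le> x \<Longrightarrow> enn_powr (ennreal x) q = ennreal (x powr q)"
  by (simp add: enn_powr_def)

lemma enn_powr_0 [simp]: "enn_powr 0 q = 0"
  by (simp add: enn_powr_def)

lemma enn_powr_eq_top_iff [simp]: "enn_powr x q = top \<longleftrightarrow> x = top"
  by (simp add: enn_powr_def infinity_ennreal_def)

lemma enn_powr_less_top_iff [simp]: "enn_powr x q < top \<longleftrightarrow> x < top"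
  by (metis enn_powr_eq_top_iff less_top)

lemma enn_powr_eq_0_iff [simp]: "enn_powr x q = 0 \<longleftrightarrow> x = 0"
  by (cases x) (auto simp: enn_powr_ennreal)

lemma enn_powr_mono: "0 \<le> q \<Longrightarrow> x \<le> y \<Longrightarrow> enn_powr x q \<le> enn_powr y q"
  by (cases x; cases y) (auto simp: enn_powr_ennreal top_unique intro!: powr_mono2)

text \<open>\<open>enn_powr\<close> fixes 0 and \<open>top\<close> for every real exponent, negative
  ones included. This agrees with \<open>0 * top = 0\<close>, so multiplicativity holds for all
  exponents; monotonicity is the law that asks for \<open>0 \<le> q\<close>.\<close>

lemma enn_powr_mult: "enn_powr (x * y) q = enn_powr x q * enn_powr y q"
proof -
  consider "x = 0 \<or> y = 0" | "x \<noteq> 0" "y \<noteq> 0" "x = top \<or> y = top" | "x < top" "y < top"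
    using less_top by blast
  then show ?thesis
  proof cases
    case 3
    then show ?thesis
      by (cases x; cases y) (auto simp: enn_powr_ennreal powr_mult simp flip: ennreal_mult)
  qed (auto simp: ennreal_mult_top ennreal_top_mult)
qed

lemma enn_powr_powr: "enn_powr (enn_powr x a) b = enn_powr x (a * b)"
  by (cases x) (auto simp: enn_powr_ennreal powr_powr)

lemma enn_powr_1 [simp]: "enn_powr x 1 = x"
  by (cases x) (auto simp: enn_powr_ennreal)

lemma enn_powr_add: "enn_powr x (a + b) = enn_powr x a * enn_powr x b"
  by (cases x) (auto simp: enn_powr_ennreal powr_add ennreal_top_mult simp flip: ennreal_mult)

lemma enn_powr_measurable [measurable]: "(\<lambda>x. enn_powr x q) \<in> borel_measurable borel"
  unfolding enn_powr_def by measurable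

section \<open>The layer-cake formula\<close>

lemma nn_integral_powr_lessThan:
  assumes "0 < q" "0 \<le> c"
  shows "(\<integral>\<^sup>+l. ennreal (q * l powr (q - 1)) * indicator {l. 0 < l \<and> l < c} l \<partial>lborel) = ennreal (c powr q)"
proof -
  have "((\<lambda>l. q * l powr (q - 1)) has_integral (q * (c powr (q - 1 + 1) / (q - 1 + 1)))) {0..c}"
    using assms by (intro has_integral_mult_right has_integral_powr_from_0) auto
  then have I: "((\<lambda>l. q * l powr (q - 1)) has_integral (c powr q)) {0..c}"
    using assms by simp
  have "(\<integral>\<^sup>+l. ennreal (q * l powr (q - 1)) * indicator {l. 0 < l \<and> l < c} l \<partial>lborel)
      = (\<integral>\<^sup>+l. ennreal (q * l powr (q - 1)) * indicator {0..c} l \<partial>lborel)"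
    using AE_lborel_singleton[of 0] AE_lborel_singleton[of c]
    by (intro nn_integral_cong_AE) (auto elim!: eventually_elim2 simp: indicator_def)
  also have "\<dots> = ennreal (c powr q)"
    using assms by (intro nn_integral_has_integral_lebesgue' I) auto
  finally show ?thesis .
qed

lemma enn_powr_layer_cake:
  assumes "0 < q"
  shows "enn_powr u q = (\<integral>\<^sup>+l. ennreal (q * l powr (q - 1)) * indicator {l. 0 < l \<and> ennreal l < u} l \<partial>lborel)"
proof (cases u)
  case (real c)
  have "{l. 0 < l \<and> ennreal l < ennreal c} = {l. 0 < l \<and> l < c}"
    by (auto simp: ennreal_less_iff)
  then show ?thesis
    using real assms by (simp only: nn_integral_powr_lessThan enn_powr_ennreal)
next
  case top
  \<comment> \<open>For an infinite argument the level set is the whole half-line; cutting it at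
    \<open>n powr (1/q)\<close> leaves mass exactly n, so the integral exceeds every natural
    number.\<close>
  have "of_nat n \<le> (\<integral>\<^sup>+l. ennreal (q * l powr (q - 1)) * indicator {l. 0 < l \<and> ennreal l < u} l \<partial>lborel)"
    for n
  proof -
    have "of_nat n = ennreal ((real n powr (1/q)) powr q)"
      using assms by (simp add: powr_powr ennreal_of_nat_eq_real_of_nat)
    also have "\<dots> = (\<integral>\<^sup>+l. ennreal (q * l powr (q - 1)) * indicator {l. 0 < l \<and> l < real n powr (1/q)} l \<partial>lborel)"
      using assms by (simp add: nn_integral_powr_lessThan)
    also have "\<dots> \<le> (\<integral>\<^sup>+l. ennreal (q * l powr (q - 1)) * indicator {l. 0 < l \<and> ennreal l < u} l \<partial>lborel)"
      by (intro nn_integral_mono) (auto simp: indicator_def top)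
    finally show ?thesis .
  qed
  then have "(\<integral>\<^sup>+l. ennreal (q * l powr (q - 1)) * indicator {l. 0 < l \<and> ennreal l < u} l \<partial>lborel) = top"
    by (meson ennreal_Ex_less_of_nat leD less_top)
  then show ?thesis
    by (simp add: top)
qed

section \<open>Maximal operators of doubling measures\<close>

text \<open>The dilation factor 5 is the one of the Vitali covering lemma, so one use of
  \<open>doubling\<close> pays for each selected ball. The locale is instantiated with Lebesgue
  measure, with \<open>w dx\<close> and with \<open>w^(-1/(p-1)) dx\<close>.\<close>

locale doubling_measure =
  fixes M :: "'a::euclidean_space measure" and D :: real
  assumes sets_M [measurable_cong]: "sets M = sets lebesgue"
    and ball_finite: "emeasure M (ball x t) < top"
    and ball_pos: "0 < t \<Longrightarrow> 0 < emeasure M (ball x t)"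
    and doubling: "0 < t \<Longrightarrow> emeasure M (ball x (5 * t)) \<le> ennreal D * emeasure M (ball x t)"
begin

lemma space_M [simp]: "space M = UNIV"
  using sets_eq_imp_space_eq[OF sets_M] by simp

lemma sets_open [measurable]: "open S \<Longrightarrow> S \<in> sets M"
  unfolding sets_M by (rule sets_completionI_sets) simp

lemma sigma_finite_M: "sigma_finite_measure M"
proof
  have "(\<Union>n::nat. ball (0::'a) (real n)) = UNIV"
    by (auto simp: reals_Archimedean2)
  then show "\<exists>A. countable A \<and> A \<subseteq> sets M \<and> \<Union> A = space M \<and> (\<forall>a\<in>A. emeasure M a \<noteq> \<infinity>)"
    using ball_finite[of 0]
    by (intro exI[of _ "range (\<lambda>n::nat. ball 0 (real n))"]) (auto simp: less_top)
qed

text \<open>Vitali's lemma selects countably many disjoint balls whose fivefold dilates cover the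
  whole union. Doubling costs a factor \<open>D\<close> on each of them, and disjointness bounds the
  sum of the integrals of \<open>h\<close> by its total integral. The common bound \<open>R\<close>
  on the radii is what Vitali's lemma requires.\<close>

lemma covering_bound:
  assumes h [measurable]: "h \<in> borel_measurable M"
    and F: "\<And>b. b \<in> F \<Longrightarrow> 0 < snd b \<and> snd b \<le> R"
    and le: "\<And>b. b \<in> F \<Longrightarrow> emeasure M (ball (fst b) (snd b)) \<le> (\<integral>\<^sup>+y\<in>ball (fst b) (snd b). h y \<partial>M)"
  shows "emeasure M (\<Union>b\<in>F. ball (fst b) (snd b)) \<le> ennreal D * (\<integral>\<^sup>+y. h y \<partial>M)"
proof -
  obtain C where C: "countable C" "C \<subseteq> F"
    "pairwise (\<lambda>i j. disjnt (ball (fst i) (snd i)) (ball (fst j) (snd j))) C"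
    "(\<Union>b\<in>F. ball (fst b) (snd b)) \<subseteq> (\<Union>b\<in>C. ball (fst b) (5 * snd b))"
    using Vitali_covering_lemma_balls[where a = fst and r = snd, OF order_refl F] by blast
  have disj: "disjoint_family_on (\<lambda>b. ball (fst b) (snd b)) C"
    using C(3) by (auto simp: disjoint_family_on_def pairwise_def disjnt_def)
  have "emeasure M (\<Union>b\<in>F. ball (fst b) (snd b)) \<le> emeasure M (\<Union>b\<in>C. ball (fst b) (5 * snd b))"
    by (intro emeasure_mono C sets_open) auto
  also have "\<dots> \<le> (\<integral>\<^sup>+b. emeasure M (ball (fst b) (5 * snd b)) \<partial>count_space C)"
    using C(1) by (intro emeasure_countable_UN_le) auto
  also have "\<dots> \<le> (\<integral>\<^sup>+b. ennreal D * (\<integral>\<^sup>+y\<in>ball (fst b) (snd b). h y \<partial>M) \<partial>count_space C)"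
    using C(2) F le by (intro nn_integral_mono order_trans[OF doubling] mult_left_mono) auto
  also have "\<dots> = ennreal D * (\<integral>\<^sup>+b. (\<integral>\<^sup>+y\<in>ball (fst b) (snd b). h y \<partial>M) \<partial>count_space C)"
    by (intro nn_integral_cmult) auto
  also have "(\<integral>\<^sup>+b. (\<integral>\<^sup>+y\<in>ball (fst b) (snd b). h y \<partial>M) \<partial>count_space C)
      = (\<integral>\<^sup>+b. emeasure (density M h) (ball (fst b) (snd b)) \<partial>count_space C)"
    by (intro nn_integral_cong) (simp add: emeasure_density)
  \<comment> \<open>Reading the integrals of \<open>h\<close> as values of the measure
    \<open>density M h\<close> turns the sum over disjoint balls into countable additivity.\<close>
  also have "\<dots> = emeasure (density M h) (\<Union>b\<in>C. ball (fst b) (snd b))"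
    using C(1) disj by (intro emeasure_UN_countable[symmetric]) auto
  also have "\<dots> \<le> emeasure (density M h) (space M)"
    by (intro emeasure_mono) auto
  also have "\<dots> = (\<integral>\<^sup>+y. h y \<partial>M)"
    by (subst emeasure_density) auto
  finally show ?thesis
    by (simp add: mult_left_mono)
qed

text \<open>The uncentred maximal operator of \<open>M\<close>, over balls of radius at most
  \<open>R\<close>. Uncentred balls make superlevel sets unions of open balls, hence measurable for
  any \<open>g\<close>, and let one ball compete at all of its points; the truncation gives the
  bounded radii needed for Vitali.\<close>

definition maxop :: "real \<Rightarrow> ('a \<Rightarrow> ennreal) \<Rightarrow> 'a \<Rightarrow> ennreal" where
  "maxop R g y = (SUP b\<in>{b. 0 < snd b \<and> snd b \<le> R \<and> y \<in> ball (fst b) (snd b)}.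
     (\<integral>\<^sup>+z\<in>ball (fst b) (snd b). g z \<partial>M) / emeasure M (ball (fst b) (snd b)))"

lemma le_maxop:
  assumes "0 < t" "t \<le> R" "y \<in> ball x t"
  shows "(\<integral>\<^sup>+z\<in>ball x t. g z \<partial>M) / emeasure M (ball x t) \<le> maxop R g y"
  unfolding maxop_def by (rule SUP_upper2[of "(x, t)"]) (use assms in auto)

lemma maxop_superlevel:
  "{y. c < maxop R g y} = (\<Union>b\<in>{b. 0 < snd b \<and> snd b \<le> R \<and>
     c < (\<integral>\<^sup>+z\<in>ball (fst b) (snd b). g z \<partial>M) / emeasure M (ball (fst b) (snd b))}. ball (fst b) (snd b))"
  unfolding maxop_def less_SUP_iff by blast

lemma borel_measurable_maxop [measurable]: "maxop R g \<in> borel_measurable M"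
  by (rule borel_measurableI_greater) (simp add: maxop_superlevel sets_open open_UN)

text \<open>On a ball where the average of \<open>g\<close> exceeds \<open>2 * l\<close>, the part
  of \<open>g\<close> below \<open>l\<close> accounts for at most half of the integral, so the part
  above \<open>l\<close> still has average at least \<open>l\<close>. Only that part enters the
  covering bound, which is the form that interpolates to a strong bound.\<close>

lemma maxop_weak_type:
  assumes g [measurable]: "g \<in> borel_measurable M" and l: "0 < l"
  shows "ennreal l * emeasure M {y. ennreal (2 * l) < maxop R g y}
           \<le> ennreal D * (\<integral>\<^sup>+y\<in>{y. ennreal l < g y}. g y \<partial>M)"
proof -
  let ?E = "{y. ennreal l < g y}"
  have E [measurable]: "?E \<in> sets M"
    using measurable_sets[OF g, of "{ennreal l<..}"] by (simp add: vimage_def)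
  let ?h = "\<lambda>y. ennreal (1 / l) * (g y * indicator ?E y)"
  let ?F = "{b. 0 < snd b \<and> snd b \<le> R \<and>
     ennreal (2 * l) < (\<integral>\<^sup>+z\<in>ball (fst b) (snd b). g z \<partial>M) / emeasure M (ball (fst b) (snd b))}"
  have "emeasure M (\<Union>b\<in>?F. ball (fst b) (snd b)) \<le> ennreal D * (\<integral>\<^sup>+y. ?h y \<partial>M)"
  proof (rule covering_bound)
    fix b assume b: "b \<in> ?F"
    let ?B = "ball (fst b) (snd b)"
    obtain m where m: "emeasure M ?B = ennreal m" "0 < m"
      using ball_finite[of "fst b" "snd b"] ball_pos[of "snd b" "fst b"] b
      by (cases "emeasure M ?B") auto
    have "ennreal (2 * l * m) = ennreal (2 * l) * emeasure M ?B"
      using l m by (simp add: ennreal_mult)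
    also have "\<dots> \<le> (\<integral>\<^sup>+z\<in>?B. g z \<partial>M) / emeasure M ?B * emeasure M ?B"
      using b by (intro mult_right_mono) auto
    also have "\<dots> = (\<integral>\<^sup>+z\<in>?B. g z \<partial>M)"
      using m by (simp add: ennreal_divide_mult_cancel)
    also have "\<dots> \<le> (\<integral>\<^sup>+z. ennreal l * indicator ?B z + g z * indicator ?E z * indicator ?B z \<partial>M)"
      by (intro nn_integral_mono) (auto simp: indicator_def not_less)
    also have "\<dots> = ennreal (l * m) + (\<integral>\<^sup>+z\<in>?B. g z * indicator ?E z \<partial>M)"
      using l m by (subst nn_integral_add) (auto simp: nn_integral_cmult ennreal_mult)
    finally have "ennreal (l * m) + ennreal (l * m) \<le> ennreal (l * m) + (\<integral>\<^sup>+z\<in>?B. g z * indicator ?E z \<partial>M)"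
      using l m by (simp add: mult.assoc flip: ennreal_plus)
    \<comment> \<open>Cancelling is legitimate because \<open>l * m\<close> is finite.\<close>
    then have *: "ennreal (l * m) \<le> (\<integral>\<^sup>+z\<in>?B. g z * indicator ?E z \<partial>M)"
      by (simp add: ennreal_add_left_cancel_le)
    have "emeasure M ?B = ennreal (1 / l) * ennreal (l * m)"
      using l m by (simp flip: ennreal_mult)
    also have "\<dots> \<le> ennreal (1 / l) * (\<integral>\<^sup>+z\<in>?B. g z * indicator ?E z \<partial>M)"
      by (intro mult_left_mono *) auto
    also have "\<dots> = (\<integral>\<^sup>+z\<in>?B. ?h z \<partial>M)"
      by (subst nn_integral_cmult[symmetric]) (auto simp: mult_ac)
    finally show "emeasure M ?B \<le> (\<integral>\<^sup>+z\<in>?B. ?h z \<partial>M)" .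
  qed auto
  then have "ennreal l * emeasure M {y. ennreal (2 * l) < maxop R g y} \<le> ennreal l * (ennreal D * (\<integral>\<^sup>+y. ?h y \<partial>M))"
    unfolding maxop_superlevel by (rule mult_left_mono) simp
  also have "(\<integral>\<^sup>+y. ?h y \<partial>M) = ennreal (1 / l) * (\<integral>\<^sup>+y\<in>?E. g y \<partial>M)"
    by (intro nn_integral_cmult) auto
  also have "ennreal l * (ennreal D * (ennreal (1 / l) * (\<integral>\<^sup>+y\<in>?E. g y \<partial>M))) =
      ennreal l * ennreal (1 / l) * (ennreal D * (\<integral>\<^sup>+y\<in>?E. g y \<partial>M))"
    by (simp add: mult_ac)
  also have "ennreal l * ennreal (1 / l) = 1"
    using l by (simp flip: ennreal_mult)
  finally show ?thesis by simp
qed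

text \<open>Marcinkiewicz interpolation by hand: write the power as a layer-cake integral over
  levels \<open>2 * l\<close>, apply the weak bound at each level, exchange the integrals and
  recognise the layer-cake formula for the exponent \<open>q - 1\<close>.\<close>

lemma maxop_strong_type:
  assumes g [measurable]: "g \<in> borel_measurable M" and q: "1 < q"
  shows "(\<integral>\<^sup>+y. enn_powr (maxop R g y) q \<partial>M)
           \<le> ennreal (2 powr q * (q / (q - 1))) * ennreal D * (\<integral>\<^sup>+y. enn_powr (g y) q \<partial>M)"
proof -
  interpret sigma_finite_measure M by (rule sigma_finite_M)
  interpret P: pair_sigma_finite lborel M ..
  have level: "{y. ennreal c < u y} \<in> sets M" if "u \<in> borel_measurable M" for u :: "'a \<Rightarrow> ennreal" and c
    using measurable_sets[OF that, of "{ennreal c<..}"] by (simp add: vimage_def)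
  let ?N = "maxop R g"
  \<comment> \<open>Halving the maximal function makes level \<open>l\<close> of the half correspond
    to level \<open>2 * l\<close> of the whole, as in the weak bound; this is the source of
    \<open>2 powr q\<close>.\<close>
  have "enn_powr (?N y) q = ennreal (2 powr q) * enn_powr (?N y / 2) q" for y
  proof -
    have "?N y = ennreal 2 * (?N y / 2)"
      using ennreal_divide_mult_cancel[of 2 "?N y"] by (simp add: mult.commute)
    then show ?thesis
      by (metis enn_powr_mult enn_powr_ennreal zero_le_numeral)
  qed
  moreover have "ennreal l < ?N y / 2 \<longleftrightarrow> ennreal (2 * l) < ?N y" if "0 < l" for l y
    using that by (cases "?N y") (auto simp: ennreal_less_iff divide_ennreal ennreal_top_divide simp flip: ennreal_numeral)
  ultimately have N: "enn_powr (?N y) q = ennreal (2 powr q) *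
      (\<integral>\<^sup>+l. ennreal (q * l powr (q - 1)) * indicator {l. 0 < l \<and> ennreal (2 * l) < ?N y} l \<partial>lborel)" for y
    using q by (simp add: enn_powr_layer_cake[of q] cong: conj_cong)
  have eq: "(\<integral>\<^sup>+y. enn_powr (?N y) q \<partial>M) = ennreal (2 powr q) *
      (\<integral>\<^sup>+y. \<integral>\<^sup>+l. ennreal (q * l powr (q - 1)) * indicator {l. 0 < l \<and> ennreal (2 * l) < ?N y} l \<partial>lborel \<partial>M)"
    unfolding N by (intro nn_integral_cmult) measurable
  have "(\<integral>\<^sup>+y. \<integral>\<^sup>+l. ennreal (q * l powr (q - 1)) * indicator {l. 0 < l \<and> ennreal (2 * l) < ?N y} l \<partial>lborel \<partial>M)
      = (\<integral>\<^sup>+l. \<integral>\<^sup>+y. ennreal (q * l powr (q - 1)) * indicator {l. 0 < l \<and> ennreal (2 * l) < ?N y} l \<partial>M \<partial>lborel)"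
    by (intro P.Fubini') measurable
  also have "\<dots> \<le> (\<integral>\<^sup>+l. \<integral>\<^sup>+y. ennreal (q / (q - 1)) * ennreal D * (ennreal ((q - 1) * l powr (q - 1 - 1)) * indicator {l. 0 < l \<and> ennreal l < g y} l * g y) \<partial>M \<partial>lborel)"
  proof (rule nn_integral_mono)
    fix l :: real
    show "(\<integral>\<^sup>+y. ennreal (q * l powr (q - 1)) * indicator {l. 0 < l \<and> ennreal (2 * l) < ?N y} l \<partial>M)
        \<le> (\<integral>\<^sup>+y. ennreal (q / (q - 1)) * ennreal D * (ennreal ((q - 1) * l powr (q - 1 - 1)) * indicator {l. 0 < l \<and> ennreal l < g y} l * g y) \<partial>M)"
    proof (cases "0 < l")
      case True
      have [measurable]: "{y. ennreal l < g y} \<in> sets M" by (rule level[OF g])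
      have "(\<integral>\<^sup>+y. ennreal (q * l powr (q - 1)) * indicator {l. 0 < l \<and> ennreal (2 * l) < ?N y} l \<partial>M)
        = (\<integral>\<^sup>+y. ennreal (q * l powr (q - 1)) * indicator {y. ennreal (2 * l) < ?N y} y \<partial>M)"
        using True by (intro nn_integral_cong) (auto simp: indicator_def)
      also have "\<dots> = ennreal (q * l powr (q - 1)) * emeasure M {y. ennreal (2 * l) < ?N y}"
        by (intro nn_integral_cmult_indicator level) simp
      \<comment> \<open>One factor \<open>l\<close> is split off the density so that the left side
        of the weak bound appears.\<close>
      also have "\<dots> = ennreal (q * l powr (q - 1 - 1)) * (ennreal l * emeasure M {y. ennreal (2 * l) < ?N y})"
      proof -
        have "l powr (q - 1) = l powr (q - 1 - 1) * l"
          using True powr_add[of l "q - 1 - 1" 1] by simp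
        then show ?thesis
          using True q by (simp add: ennreal_mult mult_ac)
      qed
      also have "\<dots> \<le> ennreal (q * l powr (q - 1 - 1)) * (ennreal D * (\<integral>\<^sup>+y\<in>{y. ennreal l < g y}. g y \<partial>M))"
        by (intro mult_left_mono maxop_weak_type True g) simp
      also have "\<dots> = ennreal (q / (q - 1)) * ennreal D * ennreal ((q - 1) * l powr (q - 1 - 1)) * (\<integral>\<^sup>+y\<in>{y. ennreal l < g y}. g y \<partial>M)"
      proof -
        \<comment> \<open>The factor \<open>q / (q - 1)\<close> normalises the density to the
          layer-cake density of the exponent \<open>q - 1\<close>, which is positive because
          \<open>q\<close> exceeds 1.\<close>
        have "ennreal (q * l powr (q - 1 - 1)) = ennreal (q / (q - 1)) * ennreal ((q - 1) * l powr (q - 1 - 1))"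
          using q by (simp flip: ennreal_mult)
        then show ?thesis by (simp add: mult_ac)
      qed
      also have "\<dots> = (\<integral>\<^sup>+y. ennreal (q / (q - 1)) * ennreal D * ennreal ((q - 1) * l powr (q - 1 - 1)) * (g y * indicator {y. ennreal l < g y} y) \<partial>M)"
        by (intro nn_integral_cmult[symmetric]) measurable
      also have "\<dots> = (\<integral>\<^sup>+y. ennreal (q / (q - 1)) * ennreal D * (ennreal ((q - 1) * l powr (q - 1 - 1)) * indicator {l. 0 < l \<and> ennreal l < g y} l * g y) \<partial>M)"
        using True by (intro nn_integral_cong) (auto simp: indicator_def mult_ac)
      finally show ?thesis .
    qed simp
  qed
  also have "\<dots> = (\<integral>\<^sup>+y. \<integral>\<^sup>+l. ennreal (q / (q - 1)) * ennreal D * (ennreal ((q - 1) * l powr (q - 1 - 1)) * indicator {l. 0 < l \<and> ennreal l < g y} l * g y) \<partial>lborel \<partial>M)"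
    by (intro P.Fubini'[symmetric]) measurable
  also have "\<dots> = (\<integral>\<^sup>+y. ennreal (q / (q - 1)) * ennreal D * enn_powr (g y) q \<partial>M)"
  proof (intro nn_integral_cong)
    fix y
    have "(\<integral>\<^sup>+l. ennreal (q / (q - 1)) * ennreal D * (ennreal ((q - 1) * l powr (q - 1 - 1)) * indicator {l. 0 < l \<and> ennreal l < g y} l * g y) \<partial>lborel)
      = ennreal (q / (q - 1)) * ennreal D * ((\<integral>\<^sup>+l. ennreal ((q - 1) * l powr (q - 1 - 1)) * indicator {l. 0 < l \<and> ennreal l < g y} l \<partial>lborel) * g y)"
      by (subst nn_integral_cmult, measurable, subst nn_integral_multc, measurable)
    also have "(\<integral>\<^sup>+l. ennreal ((q - 1) * l powr (q - 1 - 1)) * indicator {l. 0 < l \<and> ennreal l < g y} l \<partial>lborel) = enn_powr (g y) (q - 1)"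
      using q by (intro enn_powr_layer_cake[symmetric]) simp
    also have "enn_powr (g y) (q - 1) * g y = enn_powr (g y) q"
      using enn_powr_add[of "g y" "q - 1" 1] by simp
    finally show "(\<integral>\<^sup>+l. ennreal (q / (q - 1)) * ennreal D * (ennreal ((q - 1) * l powr (q - 1 - 1)) * indicator {l. 0 < l \<and> ennreal l < g y} l * g y) \<partial>lborel)
      = ennreal (q / (q - 1)) * ennreal D * enn_powr (g y) q" .
  qed
  also have "\<dots> = ennreal (q / (q - 1)) * ennreal D * (\<integral>\<^sup>+y. enn_powr (g y) q \<partial>M)"
    by (intro nn_integral_cmult) measurable
  finally have "(\<integral>\<^sup>+y. enn_powr (?N y) q \<partial>M) \<le> ennreal (2 powr q) * (ennreal (q / (q - 1)) * ennreal D * (\<integral>\<^sup>+y. enn_powr (g y) q \<partial>M))"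
    unfolding eq by (rule mult_left_mono) simp
  moreover have "ennreal (2 powr q * (q / (q - 1))) = ennreal (2 powr q) * ennreal (q / (q - 1))"
    using q by (intro ennreal_mult) auto
  ultimately show ?thesis
    by (simp only: mult.assoc)
qed

end

section \<open>Muckenhoupt weights\<close>

lemma sets_lebesgue_ball [measurable]: "ball x r \<in> sets lebesgue"
  by (rule sets_completionI_sets) simp

lemma emeasure_lebesgue_ball:
  "0 \<le> r \<Longrightarrow> emeasure lebesgue (ball (x::'a::euclidean_space) r) = ennreal (unit_ball_vol (real DIM('a)) * r ^ DIM('a))"
  by (simp add: emeasure_ball)

lemma emeasure_lebesgue_ball_finite: "emeasure lebesgue (ball (x::'a::euclidean_space) r) < top"
  using emeasure_lborel_ball_finite[of x r] by simp

lemma emeasure_lebesgue_ball_pos: "0 < r \<Longrightarrow> 0 < emeasure lebesgue (ball (x::'a::euclidean_space) r)"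
  by (simp only: emeasure_lebesgue_ball less_imp_le) simp

lemma emeasure_lebesgue_ball_scale:
  assumes "0 < k" "0 < r"
  shows "emeasure lebesgue (ball (x::'a::euclidean_space) (k * r)) = ennreal (k ^ DIM('a)) * emeasure lebesgue (ball (y::'a) r)"
proof -
  have "unit_ball_vol (real DIM('a)) * (k * r) ^ DIM('a) = k ^ DIM('a) * (unit_ball_vol (real DIM('a)) * r ^ DIM('a))"
    by (simp only: power_mult_distrib mult_ac)
  then show ?thesis
    using assms by (simp only: emeasure_lebesgue_ball less_imp_le mult_nonneg_nonneg)
      (simp add: ennreal_mult'[of "k ^ DIM('a)"])
qed

section \<open>The measure of a weight on balls\<close>

lemma weight_measurable: "weight w \<Longrightarrow> w \<in> borel_measurable lebesgue"
  by (simp add: weight_def)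

lemma wmeas_eq_emeasure_density:
  "weight w \<Longrightarrow> E \<in> sets lebesgue \<Longrightarrow> wmeas w E = emeasure (density lebesgue (\<lambda>x. ennreal (w x))) E"
  unfolding wmeas_def by (intro emeasure_density[symmetric] measurable_compose[OF weight_measurable]) measurable

lemma wmeas_mono: "E \<subseteq> F \<Longrightarrow> wmeas w E \<le> wmeas w F"
  unfolding wmeas_def by (intro nn_integral_mono) (auto simp: indicator_def)

lemma wmeas_ball_finite:
  assumes "weight w" shows "wmeas w (ball x r) < top"
proof -
  have "set_integrable lebesgue (ball x r) w"
    using assms by (simp add: weight_def)
  then have "(\<integral>\<^sup>+y. ennreal (norm (indicator (ball x r) y *\<^sub>R w y)) \<partial>lebesgue) < \<infinity>"
    unfolding set_integrable_def integrable_iff_bounded by simp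
  also have "(\<integral>\<^sup>+y. ennreal (norm (indicator (ball x r) y *\<^sub>R w y)) \<partial>lebesgue) = wmeas w (ball x r)"
    using assms unfolding wmeas_def
    by (intro nn_integral_cong) (auto simp: indicator_def weight_def)
  finally show ?thesis by simp
qed

lemma set_nn_integral_pos:
  assumes g [measurable]: "g \<in> borel_measurable M" and A [measurable]: "A \<in> sets M"
    and pos: "AE x in M. 0 < g x" and "0 < emeasure M A"
  shows "0 < (\<integral>\<^sup>+x\<in>A. g x \<partial>M)"
proof (rule ccontr)
  assume "\<not> ?thesis"
  then have "AE x in M. g x * indicator A x = 0"
    by (subst (asm) not_gr_zero, subst (asm) nn_integral_0_iff_AE) auto
  with pos have "AE x in M. x \<notin> A"
    by eventually_elim (auto simp: indicator_def split: if_splits)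
  then have "A \<in> null_sets M"
    by (simp add: AE_iff_null_sets[OF A])
  with assms(4) show False by (simp add: null_sets_def)
qed

lemma wmeas_ball_pos:
  assumes "weight w" "0 < r" shows "0 < wmeas w (ball x r)"
  using assms unfolding wmeas_def weight_def
  by (intro set_nn_integral_pos emeasure_lebesgue_ball_pos) auto

text \<open>Hoelder's inequality for \<open>f = (f w^(1/p)) w^(-1/p)\<close>, raised to the power
  \<open>p\<close> and with the extra constant \<open>2 powr p\<close>, the price of a proof by
  pointwise splitting. It holds for \<open>ennreal\<close>-valued \<open>f\<close>, whether or not
  the integrals of \<open>f\<close> are finite.\<close>

lemma powr_weight_holder:
  fixes f :: "'a \<Rightarrow> ennreal" and w :: "'a \<Rightarrow> real"
  assumes p: "1 < p" and f [measurable]: "f \<in> borel_measurable M" and w [measurable]: "w \<in> borel_measurable M"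
    and A [measurable]: "A \<in> sets M" and pos: "AE x in M. 0 < w x"
    and S: "0 < (\<integral>\<^sup>+x\<in>A. ennreal (w x powr (-1 / (p - 1))) \<partial>M)" "(\<integral>\<^sup>+x\<in>A. ennreal (w x powr (-1 / (p - 1))) \<partial>M) < top"
  shows "enn_powr (\<integral>\<^sup>+x\<in>A. f x \<partial>M) p \<le> ennreal (2 powr p) *
     enn_powr (\<integral>\<^sup>+x\<in>A. ennreal (w x powr (-1 / (p - 1))) \<partial>M) (p - 1) *
     (\<integral>\<^sup>+x\<in>A. enn_powr (f x) p * ennreal (w x) \<partial>M)" (is "enn_powr ?I p \<le> _ * enn_powr ?S _ * ?F")
proof -
  let ?s = "\<lambda>x. w x powr (-1 / (p - 1))"
  \<comment> \<open>If \<open>f > l \<sigma>\<close> then \<open>f = f^p f^(1-p) \<le> f^p (l \<sigma>)^(1-p)\<close>; below \<open>l = I / (2 S)\<close> absorbs half of the left side.\<close>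
  have pt: "f x \<le> ennreal (l * ?s x) + ennreal (l powr (1 - p)) * (enn_powr (f x) p * ennreal (w x))"
    if "0 < l" "0 < w x" for l x
  proof (cases "f x")
    case (real c)
    show ?thesis
    proof (cases "c \<le> l * ?s x")
      case True
      then show ?thesis
        using real by (simp add: add_increasing2 ennreal_leI)
    next
      case False
      have ls: "0 < l * ?s x" using that by simp
      have c: "0 < c" using False ls by linarith
      have "(l * ?s x) powr (p - 1) \<le> c powr (p - 1)"
        using False ls p by (intro powr_mono2) auto
      moreover have "(l * ?s x) powr (p - 1) = l powr (p - 1) / w x"
      proof -
        have "?s x powr (p - 1) = w x powr (- 1)"
          unfolding powr_powr using p by (intro arg_cong[where f = "(powr) (w x)"]) simp
        then show ?thesis
          using that by (simp add: powr_mult powr_minus divide_inverse)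
      qed
      ultimately have "l powr (p - 1) \<le> c powr (p - 1) * w x"
        using that by (simp add: pos_divide_le_eq)
      then have "c * l powr (1 - p) * l powr (p - 1) \<le> c * l powr (1 - p) * (c powr (p - 1) * w x)"
        using c by (intro mult_left_mono) auto
      moreover have "l powr (1 - p) * l powr (p - 1) = 1"
        using that by (simp flip: powr_add)
      moreover have "c * c powr (p - 1) = c powr p"
        using c powr_add[of c 1 "p - 1"] by simp
      ultimately have "c \<le> l powr (1 - p) * (c powr p * w x)"
        by (metis mult.assoc mult.commute mult.right_neutral)
      then show ?thesis
        using real that by (simp add: enn_powr_ennreal add_increasing ennreal_leI flip: ennreal_mult)
    qed
  next
    case top
    then show ?thesis
      using that by (simp add: ennreal_top_mult ennreal_mult_top)
  qed
  have le: "?I \<le> ennreal l * ?S + ennreal (l powr (1 - p)) * ?F" if l: "0 < l" for l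
  proof -
    have "?I \<le> (\<integral>\<^sup>+x. ennreal l * (ennreal (?s x) * indicator A x) +
        ennreal (l powr (1 - p)) * (enn_powr (f x) p * ennreal (w x) * indicator A x) \<partial>M)"
      using pos
    proof (intro nn_integral_mono_AE, eventually_elim)
      fix x assume "0 < w x"
      then show "f x * indicator A x \<le> ennreal l * (ennreal (?s x) * indicator A x) +
        ennreal (l powr (1 - p)) * (enn_powr (f x) p * ennreal (w x) * indicator A x)"
        using pt[OF l, of x] l by (auto simp: indicator_def ennreal_mult)
    qed
    also have "\<dots> = ennreal l * ?S + ennreal (l powr (1 - p)) * ?F"
      by (subst nn_integral_add) (auto simp: nn_integral_cmult)
    finally show ?thesis .
  qed
  show ?thesis
  proof (cases "?F = top")
    case True
    then show ?thesis using S by (simp add: ennreal_mult_top)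
  next
    case False
    \<comment> \<open>Any fixed level shows finiteness; it is needed before half of the left side
      can be absorbed by subtraction in the reals.\<close>
    have "?I < top"
      using le[of 1] S(2) False by (auto simp: less_top[symmetric] top_unique)
    then obtain i where i: "?I = ennreal i" "0 \<le> i" by (cases ?I) auto
    obtain s where s: "?S = ennreal s" "0 < s" using S by (cases ?S) auto
    obtain F where F: "?F = ennreal F" "0 \<le> F" using False by (cases ?F) auto
    have "i powr p \<le> 2 powr p * s powr (p - 1) * F"
    proof (cases "i = 0")
      case False
      define l where "l = i / (2 * s)"
      have l: "0 < l" using False i s by (simp add: l_def)
      have "i \<le> l * s + l powr (1 - p) * F"
        using le[OF l] l i s F by (simp flip: ennreal_mult ennreal_plus)
      then have "i / 2 \<le> l powr (1 - p) * F"
        using s by (simp add: l_def field_simps)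
      then have "l powr (p - 1) * (i / 2) \<le> l powr (p - 1) * (l powr (1 - p) * F)"
        by (intro mult_left_mono) auto
      also have "\<dots> = F"
        using l by (simp add: powr_add[symmetric] flip: mult.assoc)
      finally have "l powr (p - 1) * (i / 2) \<le> F" .
      moreover have "i powr p = 2 powr p * s powr (p - 1) * (l powr (p - 1) * (i / 2))"
        using False i s by (simp add: l_def powr_divide powr_mult powr_diff field_simps)
      moreover have "2 powr p * s powr (p - 1) * (l powr (p - 1) * (i / 2)) \<le> 2 powr p * s powr (p - 1) * F"
        using calculation(1) by (intro mult_left_mono) auto
      ultimately show ?thesis by (metis)
    qed (use F p in auto)
    then show ?thesis
      using i s F by (simp add: enn_powr_ennreal flip: ennreal_mult)
  qed
qed

section \<open>Consequences of the $A_p$ condition: duality, averages, doubling\<close>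

lemma Ap_weightD_weight: "Ap_weight p w \<Longrightarrow> weight w"
  by (simp add: Ap_weight_def)

lemma Ap_weightD:
  assumes "Ap_weight p w" "1 < p"
  obtains C where "0 \<le> C" "\<And>x r. 0 < r \<Longrightarrow>
     avg w (ball x r) * enn_powr (avg (\<lambda>y. w y powr (-1 / (p - 1))) (ball x r)) (p - 1) \<le> ennreal C"
proof -
  from assms obtain C where "\<And>x r. 0 < r \<Longrightarrow>
     avg w (ball x r) * enn_powr (avg (\<lambda>y. w y powr (-1 / (p - 1))) (ball x r)) (p - 1) \<le> ennreal C"
    by (auto simp: Ap_weight_def)
  then have "avg w (ball x r) * enn_powr (avg (\<lambda>y. w y powr (-1 / (p - 1))) (ball x r)) (p - 1) \<le> ennreal (max 0 C)"
    if "0 < r" for x r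
    using that by (meson order_trans ennreal_leI max.cobounded2)
  then show ?thesis by (intro that[of "max 0 C"]) auto
qed

lemma avg_eq: "avg w B = wmeas w B / emeasure lebesgue B"
  by (simp add: avg_def wmeas_def)

text \<open>Local integrability of the dual weight is hidden in the $A_p$ bound: the average of
  \<open>w\<close> is positive, so an infinite average of the dual weight would make the product
  infinite.\<close>

lemma Ap_dual_weight_finite:
  fixes w :: "'a::euclidean_space \<Rightarrow> real"
  assumes "Ap_weight p w" "1 < p"
  shows "wmeas (\<lambda>y. w y powr (-1 / (p - 1))) (ball x r) < top"
proof (cases "0 < r")
  case True
  obtain C where C: "avg w (ball x r) * enn_powr (avg (\<lambda>y. w y powr (-1 / (p - 1))) (ball x r)) (p - 1) \<le> ennreal C"
    using Ap_weightD[OF assms] True by metis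
  have "0 < wmeas w (ball x r)"
    using wmeas_ball_pos[OF Ap_weightD_weight] assms True by blast
  then have "0 < avg w (ball x r)"
    using emeasure_lebesgue_ball_finite[of x r]
    by (simp add: avg_eq zero_less_iff_neq_zero ennreal_divide_eq_0_iff less_top)
  then have "avg (\<lambda>y. w y powr (-1 / (p - 1))) (ball x r) \<noteq> top"
    using C by (auto simp: ennreal_mult_top top_unique zero_less_iff_neq_zero)
  then show ?thesis
    using emeasure_lebesgue_ball_finite[of x r]
    by (auto simp: avg_eq less_top[symmetric] ennreal_top_divide)
next
  case False
  then have "ball x r = {}" by auto
  then show ?thesis by (simp only:) (simp add: wmeas_def)
qed

text \<open>Raising the $A_p$ inequality to the power \<open>1 / (p - 1)\<close> exchanges the two
  factors and gives the condition for the conjugate exponent \<open>p / (p - 1)\<close>, because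
  \<open>p / (p - 1) - 1 = 1 / (p - 1)\<close> and dualising twice gives back
  \<open>w\<close>.\<close>

lemma Ap_weight_dual:
  fixes w :: "'a::euclidean_space \<Rightarrow> real"
  assumes A: "Ap_weight p w" and p: "1 < p"
  shows "Ap_weight (p / (p - 1)) (\<lambda>y. w y powr (-1 / (p - 1)))"
proof -
  let ?s = "\<lambda>y. w y powr (-1 / (p - 1))"
  note w = Ap_weightD_weight[OF A]
  have [measurable]: "w \<in> borel_measurable lebesgue" by (rule weight_measurable[OF w])
  have "set_integrable lebesgue (ball x r) ?s" for x r
    unfolding set_integrable_def integrable_iff_bounded
  proof
    have "(\<integral>\<^sup>+y. ennreal (norm (indicator (ball x r) y *\<^sub>R ?s y)) \<partial>lebesgue) = wmeas ?s (ball x r)"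
      unfolding wmeas_def by (intro nn_integral_cong) (auto simp: indicator_def)
    then show "(\<integral>\<^sup>+y. ennreal (norm (indicator (ball x r) y *\<^sub>R ?s y)) \<partial>lebesgue) < \<infinity>"
      using Ap_dual_weight_finite[OF A p] by simp
  qed simp
  moreover have "AE y in lebesgue. 0 < ?s y"
    using w unfolding weight_def by (auto elim: eventually_mono)
  ultimately have ws: "weight ?s"
    unfolding weight_def by simp
  have p': "p / (p - 1) - 1 = 1 / (p - 1)" "p / (p - 1) \<noteq> 1" using p by (auto simp: field_simps)
  have inv: "?s y powr (-1 / (p / (p - 1) - 1)) = w y" for y
  proof -
    have "-1 / (p - 1) * (-1 / (1 / (p - 1))) = 1" using p by (simp add: field_simps)
    then show ?thesis using w unfolding p' powr_powr by (simp add: weight_def)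
  qed
  obtain C where C: "0 \<le> C" "\<And>x r. 0 < r \<Longrightarrow> avg w (ball x r) * enn_powr (avg ?s (ball x r)) (p - 1) \<le> ennreal C"
    using Ap_weightD[OF A p] by metis
  have "avg ?s (ball x r) * enn_powr (avg w (ball x r)) (1 / (p - 1)) \<le> ennreal (C powr (1 / (p - 1)))" if "0 < r" for x r
  proof -
    have "enn_powr (avg w (ball x r) * enn_powr (avg ?s (ball x r)) (p - 1)) (1 / (p - 1)) \<le> enn_powr (ennreal C) (1 / (p - 1))"
      using C(2)[OF that] p by (intro enn_powr_mono) auto
    then show ?thesis
      using p C(1) by (simp add: enn_powr_mult enn_powr_powr enn_powr_ennreal mult.commute)
  qed
  then show ?thesis
    unfolding Ap_weight_def inv using ws p' by auto
qed

text \<open>A form of the $A_p$ condition that can be tested on functions, uniform in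
  \<open>p \<ge> 1\<close>. For \<open>p = 1\<close> the essential supremum bounds
  \<open>1 / w\<close> in \<open>f = (1 / w) (f w)\<close>; for \<open>p > 1\<close> it is Hoelder's
  inequality followed by the $A_p$ bound.\<close>

lemma Ap_average_bound:
  fixes w :: "'a::euclidean_space \<Rightarrow> real"
  assumes A: "Ap_weight p w" and p: "1 \<le> p"
  obtains K where "0 < K" "\<And>x r f. 0 < r \<Longrightarrow> f \<in> borel_measurable lebesgue \<Longrightarrow>
    enn_powr ((\<integral>\<^sup>+y\<in>ball x r. f y \<partial>lebesgue) / emeasure lebesgue (ball x r)) p * wmeas w (ball x r)
      \<le> ennreal K * (\<integral>\<^sup>+y\<in>ball x r. enn_powr (f y) p * ennreal (w y) \<partial>lebesgue)"
proof (cases "p = 1")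
  case True
  note w = Ap_weightD_weight[OF A]
  have [measurable]: "w \<in> borel_measurable lebesgue" by (rule weight_measurable[OF w])
  from A True obtain C where C: "\<And>x r. r > 0 \<Longrightarrow>
           avg w (ball x r) * esssup (restrict_space lebesgue (ball x r)) (\<lambda>y. ennreal (inverse (w y))) \<le> ennreal C"
    by (auto simp: Ap_weight_def)
  show ?thesis
  proof (rule that[of "max 1 C"])
    fix x :: 'a and r :: real and f :: "'a \<Rightarrow> ennreal"
    assume r: "0 < r" and f [measurable]: "f \<in> borel_measurable lebesgue"
    let ?B = "ball x r" and ?S = "esssup (restrict_space lebesgue (ball x r)) (\<lambda>y. ennreal (inverse (w y)))"
    let ?F = "\<integral>\<^sup>+y\<in>?B. f y * ennreal (w y) \<partial>lebesgue"
    have "AE y in restrict_space lebesgue ?B. ennreal (inverse (w y)) \<le> ?S"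
      by (rule esssup_AE)
    then have "AE y in lebesgue. y \<in> ?B \<longrightarrow> ennreal (inverse (w y)) \<le> ?S"
      by (subst (asm) AE_restrict_space_iff) auto
    moreover have "AE y in lebesgue. 0 < w y" using w by (simp add: weight_def)
    ultimately have "AE y in lebesgue. f y * indicator ?B y \<le> ?S * (f y * ennreal (w y) * indicator ?B y)"
    proof eventually_elim
      fix y assume y: "y \<in> ?B \<longrightarrow> ennreal (inverse (w y)) \<le> ?S" "0 < w y"
      show "f y * indicator ?B y \<le> ?S * (f y * ennreal (w y) * indicator ?B y)"
      proof (cases "y \<in> ?B")
        case True
        have "f y = ennreal (inverse (w y)) * (f y * ennreal (w y))"
        proof -
          have "ennreal (inverse (w y)) * ennreal (w y) = 1"
            using y by (simp flip: ennreal_mult)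
          then show ?thesis by (metis mult.left_commute mult.right_neutral)
        qed
        also have "\<dots> \<le> ?S * (f y * ennreal (w y))"
          using y True by (intro mult_right_mono) auto
        finally show ?thesis using True by simp
      qed simp
    qed
    then have "(\<integral>\<^sup>+y\<in>?B. f y \<partial>lebesgue) \<le> (\<integral>\<^sup>+y. ?S * (f y * ennreal (w y) * indicator ?B y) \<partial>lebesgue)"
      by (rule nn_integral_mono_AE)
    also have "\<dots> = ?S * ?F"
      by (intro nn_integral_cmult) measurable
    finally have "(\<integral>\<^sup>+y\<in>?B. f y \<partial>lebesgue) * avg w ?B \<le> ?S * ?F * avg w ?B"
      by (rule mult_right_mono) simp
    also have "\<dots> = (avg w ?B * ?S) * ?F" by (simp add: mult_ac)
    also have "\<dots> \<le> ennreal (max 1 C) * ?F"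
      using C[OF r, of x] by (intro mult_right_mono) (auto intro: order_trans ennreal_leI)
    finally show "enn_powr ((\<integral>\<^sup>+y\<in>?B. f y \<partial>lebesgue) / emeasure lebesgue ?B) p * wmeas w ?B
      \<le> ennreal (max 1 C) * (\<integral>\<^sup>+y\<in>?B. enn_powr (f y) p * ennreal (w y) \<partial>lebesgue)"
      using True by (simp add: avg_eq divide_ennreal_def mult_ac)
  qed auto
next
  case False
  with p have p: "1 < p" by simp
  let ?s = "\<lambda>y. w y powr (-1 / (p - 1))"
  note w = Ap_weightD_weight[OF A]
  have [measurable]: "w \<in> borel_measurable lebesgue" by (rule weight_measurable[OF w])
  obtain C where C: "0 \<le> C" "\<And>x r. 0 < r \<Longrightarrow> avg w (ball x r) * enn_powr (avg ?s (ball x r)) (p - 1) \<le> ennreal C"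
    using Ap_weightD[OF A p] by metis
  show ?thesis
  proof (rule that[of "2 powr p * (C + 1)"])
    fix x :: 'a and r :: real and f :: "'a \<Rightarrow> ennreal"
    assume r: "0 < r" and f [measurable]: "f \<in> borel_measurable lebesgue"
    let ?B = "ball x r"
    let ?m = "inverse (emeasure lebesgue ?B)"
    let ?I = "\<integral>\<^sup>+y\<in>?B. f y \<partial>lebesgue"
    let ?F = "\<integral>\<^sup>+y\<in>?B. enn_powr (f y) p * ennreal (w y) \<partial>lebesgue"
    have "0 < wmeas ?s ?B" "wmeas ?s ?B < top"
      using wmeas_ball_pos[OF Ap_weightD_weight[OF Ap_weight_dual[OF A p]] r] Ap_dual_weight_finite[OF A p] by auto
    then have "enn_powr ?I p \<le> ennreal (2 powr p) * enn_powr (wmeas ?s ?B) (p - 1) * ?F"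
      using w p unfolding wmeas_def weight_def by (intro powr_weight_holder) auto
    then have "enn_powr ?I p * (enn_powr ?m p * wmeas w ?B) \<le>
       ennreal (2 powr p) * enn_powr (wmeas ?s ?B) (p - 1) * ?F * (enn_powr ?m p * wmeas w ?B)"
      by (rule mult_right_mono) simp
    also have "\<dots> = ennreal (2 powr p) * (avg w ?B * enn_powr (avg ?s ?B) (p - 1)) * ?F"
    proof -
      \<comment> \<open>Of the \<open>p\<close> powers of the inverse volume, one normalises the
        integral of \<open>w\<close> and the other \<open>p - 1\<close> that of the dual
        weight.\<close>
      have "enn_powr ?m p = ?m * enn_powr ?m (p - 1)"
        using enn_powr_add[of ?m 1 "p - 1"] by simp
      then show ?thesis
        by (simp add: avg_eq divide_ennreal_def enn_powr_mult mult_ac)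
    qed
    also have "\<dots> \<le> ennreal (2 powr p) * ennreal (C + 1) * ?F"
      using C(1) by (intro mult_left_mono mult_right_mono order_trans[OF C(2)[OF r]]) (auto intro: ennreal_leI)
    finally show "enn_powr (?I / emeasure lebesgue ?B) p * wmeas w ?B \<le> ennreal (2 powr p * (C + 1)) * ?F"
      using C(1) by (simp add: divide_ennreal_def enn_powr_mult ennreal_mult mult_ac)
  qed (use C in auto)
qed

text \<open>Test the average bound on \<open>ball x (5 * t)\<close> with the indicator of
  \<open>ball x t\<close>: its average there is \<open>1 / 5 ^ DIM('a)\<close>, and its weighted
  integral is the weight of the small ball. This yields the constant
  \<open>(5 ^ DIM('a)) powr p * K\<close>.\<close>

lemma Ap_doubling:
  fixes w :: "'a::euclidean_space \<Rightarrow> real"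
  assumes A: "Ap_weight p w" and p: "1 \<le> p"
  obtains D where "0 < D" "doubling_measure (density lebesgue (\<lambda>x. ennreal (w x))) D"
proof -
  note w = Ap_weightD_weight[OF A]
  have [measurable]: "w \<in> borel_measurable lebesgue" by (rule weight_measurable[OF w])
  obtain K where K: "0 < K" "\<And>x r f. 0 < r \<Longrightarrow> f \<in> borel_measurable lebesgue \<Longrightarrow>
    enn_powr ((\<integral>\<^sup>+y\<in>ball x r. f y \<partial>lebesgue) / emeasure lebesgue (ball x r)) p * wmeas w (ball x r)
      \<le> ennreal K * (\<integral>\<^sup>+y\<in>ball x r. enn_powr (f y) p * ennreal (w y) \<partial>lebesgue)"
    using Ap_average_bound[OF A p] by blast
  let ?D = "(5 ^ DIM('a)) powr p * K"
  have D: "wmeas w (ball x (5 * t)) \<le> ennreal ?D * wmeas w (ball x t)" if t: "0 < t" for x t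
  proof -
    let ?c = "1 / 5 ^ DIM('a) :: real"
    have sub: "ball x t \<subseteq> ball x (5 * t)" using t by auto
    obtain m where m: "emeasure lebesgue (ball x t) = ennreal m" "0 < m"
      using emeasure_lebesgue_ball_finite[of x t] emeasure_lebesgue_ball_pos[OF t, of x]
      by (cases "emeasure lebesgue (ball x t)") auto
    have "(\<integral>\<^sup>+y\<in>ball x (5 * t). indicator (ball x t) y \<partial>lebesgue) = (\<integral>\<^sup>+y. indicator (ball x t) y \<partial>lebesgue)"
      using sub by (intro nn_integral_cong) (auto simp: indicator_def)
    then have "(\<integral>\<^sup>+y\<in>ball x (5 * t). indicator (ball x t) y \<partial>lebesgue) / emeasure lebesgue (ball x (5 * t)) = ennreal ?c"
    proof -
      have "emeasure lebesgue (ball x (5 * t)) = ennreal (5 ^ DIM('a) * m)"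
        using emeasure_lebesgue_ball_scale[of 5 t x x] t m by (simp add: ennreal_mult)
      moreover have "(\<integral>\<^sup>+y. indicator (ball x t) y \<partial>lebesgue) = ennreal m"
        using m(1) by (subst nn_integral_indicator) auto
      moreover have "m / (5 ^ DIM('a) * m) = ?c" using m by simp
      ultimately show ?thesis
        using m \<open>_ = (\<integral>\<^sup>+y. indicator (ball x t) y \<partial>lebesgue)\<close> by (simp only: divide_ennreal less_imp_le zero_less_mult_iff) (simp add: divide_ennreal)
    qed
    moreover have "(\<integral>\<^sup>+y\<in>ball x (5 * t). enn_powr (indicator (ball x t) y) p * ennreal (w y) \<partial>lebesgue) = wmeas w (ball x t)"
      unfolding wmeas_def using sub enn_powr_ennreal[of 1 p] by (intro nn_integral_cong) (auto simp: indicator_def)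
    ultimately have "enn_powr (ennreal ?c) p * wmeas w (ball x (5 * t)) \<le> ennreal K * wmeas w (ball x t)"
      using K(2)[of "5 * t" "indicator (ball x t)" x] t by simp
    then have "ennreal ((5 ^ DIM('a)) powr p) * (enn_powr (ennreal ?c) p * wmeas w (ball x (5 * t)))
      \<le> ennreal ((5 ^ DIM('a)) powr p) * (ennreal K * wmeas w (ball x t))"
      by (rule mult_left_mono) simp
    moreover have "ennreal ((5 ^ DIM('a)) powr p) * enn_powr (ennreal ?c) p = 1"
      by (simp add: enn_powr_ennreal powr_divide flip: ennreal_mult)
    moreover have "ennreal ?D = ennreal ((5 ^ DIM('a)) powr p) * ennreal K"
      using K(1) by (intro ennreal_mult) auto
    ultimately show ?thesis
      by (simp only: mult.assoc[symmetric] mult_1)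
  qed
  show ?thesis
  proof (rule that)
    show "0 < ?D" using K by simp
    show "doubling_measure (density lebesgue (\<lambda>x. ennreal (w x))) ?D"
    proof
      show "sets (density lebesgue (\<lambda>x. ennreal (w x))) = sets lebesgue" by simp
    next
      fix x :: 'a and t :: real
      note eq = wmeas_eq_emeasure_density[OF w sets_lebesgue_ball, symmetric]
      show "emeasure (density lebesgue (\<lambda>x. ennreal (w x))) (ball x t) < top"
        unfolding eq by (rule wmeas_ball_finite[OF w])
      assume t: "0 < t"
      show "0 < emeasure (density lebesgue (\<lambda>x. ennreal (w x))) (ball x t)"
        unfolding eq by (rule wmeas_ball_pos[OF w t])
      show "emeasure (density lebesgue (\<lambda>x. ennreal (w x))) (ball x (5 * t))
        \<le> ennreal ?D * emeasure (density lebesgue (\<lambda>x. ennreal (w x))) (ball x t)"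
        unfolding eq by (rule D[OF t])
    qed
  qed
qed

section \<open>Weighted bounds for the truncated maximal operator\<close>

lemma doubling_measure_lebesgue: "doubling_measure (lebesgue :: 'a::euclidean_space measure) (5 ^ DIM('a))"
proof
  show "sets lebesgue = sets (lebesgue :: 'a measure)" ..
next
  fix x :: 'a and t :: real
  show "emeasure lebesgue (ball x t) < top" by (rule emeasure_lebesgue_ball_finite)
  assume t: "0 < t"
  show "0 < emeasure lebesgue (ball x t)" by (rule emeasure_lebesgue_ball_pos[OF t])
  show "emeasure lebesgue (ball x (5 * t)) \<le> ennreal (5 ^ DIM('a)) * emeasure lebesgue (ball x t)"
    using emeasure_lebesgue_ball_scale[of 5 t x x] t by simp
qed

interpretation leb: doubling_measure "lebesgue :: 'a::euclidean_space measure" "5 ^ DIM('a)"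
  by (rule doubling_measure_lebesgue)

lemma ennreal_inverse_mult_self: "0 < c \<Longrightarrow> ennreal (inverse c) * ennreal c = 1"
  by (simp flip: ennreal_mult)

text \<open>Lerner's pointwise inequality. Write m, v, s for the Lebesgue, w- and dual measure of a
  ball B containing \<open>x\<close>, and I for the integral of \<open>f\<close> over B. Then
  \<open>(I/m)^(p-1)\<close> equals \<open>(I/s)^(p-1) * m / v\<close> times the $A_p$ product of B.
  The number \<open>I/s\<close> is the dual average of \<open>g\<close>, so
  \<open>(I/s)^(p-1) * m / v\<close> is at most the w-average of \<open>h\<close> over B.\<close>

lemma maxop_lebesgue_le:
  fixes f :: "'a::euclidean_space \<Rightarrow> ennreal"
  assumes p: "1 < p" and w [measurable]: "w \<in> borel_measurable lebesgue" and pos: "AE x in lebesgue. 0 < w x"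
    and W: "doubling_measure (density lebesgue (\<lambda>x. ennreal (w x))) D"
    and S: "doubling_measure (density lebesgue (\<lambda>x. ennreal (w x powr (-1 / (p - 1))))) E"
    and C: "0 \<le> C" "\<And>x r. 0 < r \<Longrightarrow> avg w (ball x r) * enn_powr (avg (\<lambda>y. w y powr (-1 / (p - 1))) (ball x r)) (p - 1) \<le> ennreal C"
    and f [measurable]: "f \<in> borel_measurable lebesgue"
    and g: "g = (\<lambda>x. f x * ennreal (inverse (w x powr (-1 / (p - 1)))))"
    and h: "h = (\<lambda>x. enn_powr (doubling_measure.maxop (density lebesgue (\<lambda>x. ennreal (w x powr (-1 / (p - 1))))) R g x) (p - 1) * ennreal (inverse (w x)))"
  shows "leb.maxop R f x \<le> enn_powr (ennreal C * doubling_measure.maxop (density lebesgue (\<lambda>x. ennreal (w x))) R h x) (1 / (p - 1))"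
  unfolding leb.maxop_def
proof (rule SUP_least)
  let ?s = "\<lambda>y. w y powr (-1 / (p - 1))"
  let ?W = "density lebesgue (\<lambda>x. ennreal (w x))" and ?S = "density lebesgue (\<lambda>x. ennreal (?s x))"
  interpret W: doubling_measure ?W D by (rule W)
  interpret S: doubling_measure ?S E by (rule S)
  have N [measurable]: "S.maxop R g \<in> borel_measurable lebesgue"
    using S.borel_measurable_maxop[of R g] by simp
  have h [measurable]: "h \<in> borel_measurable lebesgue" and hN: "\<And>y. h y = enn_powr (S.maxop R g y) (p - 1) * ennreal (inverse (w y))"
    unfolding h by measurable
  have gm [measurable]: "g \<in> borel_measurable lebesgue" unfolding g by measurable
  fix b assume b: "b \<in> {b. 0 < snd b \<and> snd b \<le> R \<and> x \<in> ball (fst b) (snd b)}"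
  let ?B = "ball (fst b) (snd b)"
  let ?I = "\<integral>\<^sup>+y\<in>?B. f y \<partial>lebesgue" and ?J = "\<integral>\<^sup>+y\<in>?B. enn_powr (S.maxop R g y) (p - 1) \<partial>lebesgue"
  have t: "0 < snd b" "snd b \<le> R" "x \<in> ?B" using b by auto
  define m where "m = emeasure lebesgue ?B"
  define v where "v = emeasure ?W ?B"
  define s where "s = emeasure ?S ?B"
  have m: "0 < m" "m < top" 
    unfolding m_def using emeasure_lebesgue_ball_pos[OF t(1)] emeasure_lebesgue_ball_finite by blast+
  have v: "0 < v" "v < top" unfolding v_def using W.ball_pos W.ball_finite t by auto
  have s: "0 < s" "s < top" unfolding s_def using S.ball_pos S.ball_finite t by auto
  have vs: "wmeas w ?B = v" "wmeas ?s ?B = s"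
    unfolding v_def s_def wmeas_def by (simp_all add: emeasure_density)
  have "(\<integral>\<^sup>+y\<in>?B. g y \<partial>?S) = (\<integral>\<^sup>+y. ennreal (?s y) * (g y * indicator ?B y) \<partial>lebesgue)"
    by (intro nn_integral_density) measurable
  also have "\<dots> = ?I"
    using pos
  proof (intro nn_integral_cong_AE, eventually_elim)
    fix y assume "0 < w y"
    then have "ennreal (?s y) * (g y * indicator ?B y) = (ennreal (inverse (?s y)) * ennreal (?s y)) * (f y * indicator ?B y)"
      by (simp add: g mult_ac)
    then show "ennreal (?s y) * (g y * indicator ?B y) = f y * indicator ?B y"
      using \<open>0 < w y\<close> by (simp only: ennreal_inverse_mult_self powr_gt_zero) simp
  qed
  \<comment> \<open>The dual density cancels against its inverse in \<open>g\<close> wherever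
    \<open>w\<close> is positive, that is almost everywhere.\<close>
  finally have gI: "(\<integral>\<^sup>+y\<in>?B. g y \<partial>?S) = ?I" .
  have "(\<integral>\<^sup>+y\<in>?B. h y \<partial>?W) = (\<integral>\<^sup>+y. ennreal (w y) * (h y * indicator ?B y) \<partial>lebesgue)"
    by (intro nn_integral_density) measurable
  also have "\<dots> = ?J"
    using pos
  proof (intro nn_integral_cong_AE, eventually_elim)
    fix y assume "0 < w y"
    have "ennreal (w y) * (h y * indicator ?B y) = (ennreal (inverse (w y)) * ennreal (w y)) * (enn_powr (S.maxop R g y) (p - 1) * indicator ?B y)"
      by (simp add: hN mult_ac)
    then show "ennreal (w y) * (h y * indicator ?B y) = enn_powr (S.maxop R g y) (p - 1) * indicator ?B y"
      using \<open>0 < w y\<close> by (simp only: ennreal_inverse_mult_self) simp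
  qed
  finally have hJ: "?J / v \<le> W.maxop R h x"
    using W.le_maxop[OF t, of h] by (simp add: v_def)
  \<comment> \<open>Since \<open>S.maxop\<close> is uncentred, \<open>?B\<close> competes at each of
    its points, so the constant \<open>?I / s\<close> lies below \<open>S.maxop R g\<close> on all
    of \<open>?B\<close> and can be integrated.\<close>
  have J: "enn_powr (?I / s) (p - 1) * m \<le> ?J"
  proof -
    have "enn_powr (?I / s) (p - 1) * m = (\<integral>\<^sup>+y\<in>?B. enn_powr (?I / s) (p - 1) \<partial>lebesgue)"
      unfolding m_def by (rule nn_integral_cmult_indicator[symmetric]) simp
    also have "\<dots> \<le> ?J"
    proof (rule nn_integral_mono)
      fix y
      have "?I / s \<le> S.maxop R g y" if "y \<in> ?B"
        using S.le_maxop[OF t(1,2) that, of g] unfolding gI s_def[symmetric] .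
      then show "enn_powr (?I / s) (p - 1) * indicator ?B y \<le> enn_powr (S.maxop R g y) (p - 1) * indicator ?B y"
        using p by (cases "y \<in> ?B") (auto intro!: enn_powr_mono simp del: mem_ball)
    qed
    finally show ?thesis .
  qed
  have "enn_powr (?I / m) (p - 1) = enn_powr (?I / s) (p - 1) * m * (v / m * enn_powr (s / m) (p - 1)) / v"
  proof -
    have "?I / m = ?I / s * (s / m)"
      using s by (metis ennreal_divide_mult_cancel ennreal_times_divide)
    then have "enn_powr (?I / m) (p - 1) = enn_powr (?I / s) (p - 1) * enn_powr (s / m) (p - 1)"
      by (simp add: enn_powr_mult)
    moreover have "v / m * m = v" using m by (rule ennreal_divide_mult_cancel)
    moreover have "enn_powr (?I / s) (p - 1) * m * (v / m * enn_powr (s / m) (p - 1)) = enn_powr (?I / s) (p - 1) * enn_powr (s / m) (p - 1) * (v / m * m)"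
      by (simp only: mult_ac)
    ultimately show ?thesis
      using v by (simp add: ennreal_mult_divide_eq)
  qed
  also have "\<dots> \<le> ?J * ennreal C / v"
    using C(2)[OF t(1), of "fst b"] unfolding avg_eq vs m_def[symmetric]
    by (intro divide_right_mono_ennreal mult_mono J) auto
  also have "\<dots> = ennreal C * (?J / v)"
    by (simp add: divide_ennreal_def mult_ac)
  also have "\<dots> \<le> ennreal C * W.maxop R h x"
    by (intro mult_left_mono hJ) simp
  finally have "enn_powr (?I / m) (p - 1) \<le> ennreal C * W.maxop R h x" .
  then have "enn_powr (enn_powr (?I / m) (p - 1)) (1 / (p - 1)) \<le> enn_powr (ennreal C * W.maxop R h x) (1 / (p - 1))"
    using p by (intro enn_powr_mono) auto
  then show "?I / emeasure lebesgue ?B \<le> enn_powr (ennreal C * W.maxop R h x) (1 / (p - 1))"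
    using p by (simp add: enn_powr_powr m_def)
qed

text \<open>The p-th power of Lerner's inequality involves the w-maximal function of
  \<open>h\<close> to the conjugate power \<open>p / (p - 1)\<close>. The strong bound for
  \<open>w dx\<close> removes that operator, the strong bound for the dual measure removes the one
  inside \<open>h\<close>, and the powers of \<open>w\<close> recombine at both stages. The constant
  does not depend on \<open>R\<close>.\<close>

lemma maxop_lebesgue_strong_type:
  fixes w :: "'a::euclidean_space \<Rightarrow> real"
  assumes A: "Ap_weight p w" and p: "1 < p"
  obtains C where "0 < C" "\<And>R f. f \<in> borel_measurable lebesgue \<Longrightarrow>
    (\<integral>\<^sup>+x. enn_powr (leb.maxop R f x) p * ennreal (w x) \<partial>lebesgue) \<le> ennreal C * (\<integral>\<^sup>+x. enn_powr (f x) p * ennreal (w x) \<partial>lebesgue)"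
proof -
  let ?q = "p / (p - 1)" and ?s = "\<lambda>y. w y powr (-1 / (p - 1))"
  let ?W = "density lebesgue (\<lambda>x. ennreal (w x))" and ?S = "density lebesgue (\<lambda>x. ennreal (?s x))"
  have q: "1 < ?q" using p by simp
  note w = Ap_weightD_weight[OF A]
  have [measurable]: "w \<in> borel_measurable lebesgue" by (rule weight_measurable[OF w])
  have pos: "AE x in lebesgue. 0 < w x" using w by (simp add: weight_def)
  obtain C where C: "0 \<le> C" "\<And>x r. 0 < r \<Longrightarrow> avg w (ball x r) * enn_powr (avg ?s (ball x r)) (p - 1) \<le> ennreal C"
    using Ap_weightD[OF A p] by metis
  obtain D where D: "0 < D" "doubling_measure ?W D"
    using Ap_doubling[OF A less_imp_le[OF p]] by metis
  obtain E where E: "0 < E" "doubling_measure ?S E"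
    using Ap_doubling[OF Ap_weight_dual[OF A p] less_imp_le[OF q]] by metis
  interpret W: doubling_measure ?W D by (rule D)
  interpret S: doubling_measure ?S E by (rule E)
  let ?c1 = "2 powr ?q * (?q / (?q - 1))" and ?c2 = "2 powr p * (p / (p - 1))"
  let ?K = "C powr ?q * (?c1 * D * (?c2 * E))"
  show ?thesis
  proof (rule that[of "?K + 1"])
    \<comment> \<open>\<open>C\<close> is only known to be nonnegative; adding 1 makes the constant
      positive.\<close>
    show "0 < ?K + 1"
      using p q C D E by (intro add_nonneg_pos mult_nonneg_nonneg) auto
    fix R and f :: "'a \<Rightarrow> ennreal" assume f [measurable]: "f \<in> borel_measurable lebesgue"
    define g where "g = (\<lambda>x. f x * ennreal (inverse (?s x)))"
    define h where "h = (\<lambda>x. enn_powr (S.maxop R g x) (p - 1) * ennreal (inverse (w x)))"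
    have gm [measurable]: "g \<in> borel_measurable lebesgue" unfolding g_def by measurable
    have N [measurable]: "S.maxop R g \<in> borel_measurable lebesgue"
      using S.borel_measurable_maxop[of R g] by simp
    have Wm [measurable]: "W.maxop R h \<in> borel_measurable lebesgue"
      using W.borel_measurable_maxop[of R h] by simp
    have hm [measurable]: "h \<in> borel_measurable lebesgue" unfolding h_def by measurable
    have "(\<integral>\<^sup>+x. enn_powr (leb.maxop R f x) p * ennreal (w x) \<partial>lebesgue)
       \<le> (\<integral>\<^sup>+x. ennreal (w x) * (ennreal (C powr ?q) * enn_powr (W.maxop R h x) ?q) \<partial>lebesgue)"
    proof (rule nn_integral_mono)
      fix x
      have "enn_powr (leb.maxop R f x) p \<le> enn_powr (enn_powr (ennreal C * W.maxop R h x) (1 / (p - 1))) p"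
        using p by (intro enn_powr_mono maxop_lebesgue_le[OF p _ pos D(2) E(2) C _ g_def h_def]) auto
      also have "\<dots> = ennreal (C powr ?q) * enn_powr (W.maxop R h x) ?q"
        using C(1) by (simp add: enn_powr_powr enn_powr_mult enn_powr_ennreal powr_powr)
      finally show "enn_powr (leb.maxop R f x) p * ennreal (w x) \<le> ennreal (w x) * (ennreal (C powr ?q) * enn_powr (W.maxop R h x) ?q)"
        by (subst mult.commute) (rule mult_left_mono, auto)
    qed
    also have "\<dots> = (\<integral>\<^sup>+x. ennreal (C powr ?q) * enn_powr (W.maxop R h x) ?q \<partial>?W)"
      by (intro nn_integral_density[symmetric]) measurable
    also have "\<dots> = ennreal (C powr ?q) * (\<integral>\<^sup>+x. enn_powr (W.maxop R h x) ?q \<partial>?W)"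
      by (intro nn_integral_cmult) measurable
    also have "\<dots> \<le> ennreal (C powr ?q) * (ennreal ?c1 * ennreal D * (\<integral>\<^sup>+x. enn_powr (h x) ?q \<partial>?W))"
      using q by (intro mult_left_mono W.maxop_strong_type) auto
    also have "(\<integral>\<^sup>+x. enn_powr (h x) ?q \<partial>?W) = (\<integral>\<^sup>+x. ennreal (w x) * enn_powr (h x) ?q \<partial>lebesgue)"
      by (intro nn_integral_density) measurable
    also have "\<dots> = (\<integral>\<^sup>+x. ennreal (?s x) * enn_powr (S.maxop R g x) p \<partial>lebesgue)"
      using pos
    proof (intro nn_integral_cong_AE, eventually_elim)
      fix x assume x: "0 < w x"
      \<comment> \<open>The weight left over from \<open>h\<close> to the power \<open>?q\<close> is
        \<open>w^(1 - ?q)\<close>, which is the dual weight because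
        \<open>1 - ?q = -1 / (p - 1)\<close>.\<close>
      have "w x * inverse (w x) powr ?q = w x powr (1 + - ?q)"
        using x by (subst powr_add) (simp add: powr_minus inverse_powr)
      also have "1 + - ?q = - 1 / (p - 1)" using p by (simp add: field_simps)
      finally have *: "ennreal (w x) * enn_powr (ennreal (inverse (w x))) ?q = ennreal (?s x)"
        using x by (simp add: enn_powr_ennreal flip: ennreal_mult)
      have "enn_powr (h x) ?q = enn_powr (S.maxop R g x) p * enn_powr (ennreal (inverse (w x))) ?q"
        using p by (simp add: h_def enn_powr_mult enn_powr_powr)
      then show "ennreal (w x) * enn_powr (h x) ?q = ennreal (?s x) * enn_powr (S.maxop R g x) p"
        unfolding *[symmetric] by (simp only: mult_ac)
    qed
    also have "\<dots> = (\<integral>\<^sup>+x. enn_powr (S.maxop R g x) p \<partial>?S)"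
      by (intro nn_integral_density[symmetric]) measurable
    also have "ennreal (C powr ?q) * (ennreal ?c1 * ennreal D * (\<integral>\<^sup>+x. enn_powr (S.maxop R g x) p \<partial>?S))
      \<le> ennreal (C powr ?q) * (ennreal ?c1 * ennreal D * (ennreal ?c2 * ennreal E * (\<integral>\<^sup>+x. enn_powr (g x) p \<partial>?S)))"
      using p by (intro mult_left_mono S.maxop_strong_type) auto
    also have "(\<integral>\<^sup>+x. enn_powr (g x) p \<partial>?S) = (\<integral>\<^sup>+x. ennreal (?s x) * enn_powr (g x) p \<partial>lebesgue)"
      by (intro nn_integral_density) measurable
    also have "\<dots> = (\<integral>\<^sup>+x. enn_powr (f x) p * ennreal (w x) \<partial>lebesgue)"
      using pos
    proof (intro nn_integral_cong_AE, eventually_elim)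
      fix x assume x: "0 < w x"
      \<comment> \<open>Conversely, the dual weight to the power \<open>1 - p\<close> is
        \<open>w\<close>, so the norm of \<open>g\<close> for the dual measure becomes the weighted
        norm of \<open>f\<close>.\<close>
      have "inverse (?s x) = w x powr (1 / (p - 1))"
        by (simp add: powr_minus)
      then have "?s x * inverse (?s x) powr p = w x powr (-1 / (p - 1) + 1 / (p - 1) * p)"
        by (simp only: powr_powr powr_add)
      also have "-1 / (p - 1) + 1 / (p - 1) * p = (p - 1) / (p - 1)" by (simp only: diff_divide_distrib) simp
      also have "\<dots> = 1" using p by simp
      finally have "?s x * inverse (?s x) powr p = w x" using x by simp
      then have *: "ennreal (?s x) * enn_powr (ennreal (inverse (?s x))) p = ennreal (w x)"
        using x by (simp add: enn_powr_ennreal flip: ennreal_mult)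
      show "ennreal (?s x) * enn_powr (g x) p = enn_powr (f x) p * ennreal (w x)"
        unfolding *[symmetric] g_def enn_powr_mult by (simp only: mult_ac)
    qed
    also have "ennreal (C powr ?q) * (ennreal ?c1 * ennreal D * (ennreal ?c2 * ennreal E * (\<integral>\<^sup>+x. enn_powr (f x) p * ennreal (w x) \<partial>lebesgue)))
       = ennreal ?K * (\<integral>\<^sup>+x. enn_powr (f x) p * ennreal (w x) \<partial>lebesgue)"
    proof -
      have "ennreal ?K = ennreal (C powr ?q) * (ennreal ?c1 * ennreal D * (ennreal ?c2 * ennreal E))"
      proof -
        have "0 \<le> ?c1" "0 \<le> ?c2" using p q by (auto intro!: mult_nonneg_nonneg divide_nonneg_nonneg)
        note nonneg = mult_nonneg_nonneg[OF this(1) less_imp_le[OF D(1)]] mult_nonneg_nonneg[OF this(2) less_imp_le[OF E(1)]]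
          this less_imp_le[OF D(1)] less_imp_le[OF E(1)]
        show ?thesis
          by (subst ennreal_mult[OF powr_ge_zero mult_nonneg_nonneg[OF nonneg(1,2)]], subst ennreal_mult[OF nonneg(1,2)],
              subst ennreal_mult[OF nonneg(3,5)], subst ennreal_mult[OF nonneg(4,6)]) (rule refl)
      qed
      then show ?thesis by (simp only: mult.assoc)
    qed
    also have "\<dots> \<le> ennreal (?K + 1) * (\<integral>\<^sup>+x. enn_powr (f x) p * ennreal (w x) \<partial>lebesgue)"
      by (intro mult_right_mono ennreal_leI) auto
    finally show "(\<integral>\<^sup>+x. enn_powr (leb.maxop R f x) p * ennreal (w x) \<partial>lebesgue)
      \<le> ennreal (?K + 1) * (\<integral>\<^sup>+x. enn_powr (f x) p * ennreal (w x) \<partial>lebesgue)" .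
  qed
qed

text \<open>The superlevel set is a union of balls with large Lebesgue averages, but the covering
  lemma is applied to \<open>w dx\<close>: the $A_1$ average bound turns a Lebesgue average above
  \<open>c\<close> into \<open>c * w(B)\<close> at most \<open>K\<close> times the integral of
  \<open>f w\<close> over B.\<close>

lemma maxop_lebesgue_weak_type:
  fixes w :: "'a::euclidean_space \<Rightarrow> real"
  assumes A: "Ap_weight 1 w"
  obtains C where "0 < C" "\<And>R f c. f \<in> borel_measurable lebesgue \<Longrightarrow> 0 < c \<Longrightarrow>
    ennreal c * wmeas w {x. ennreal c < leb.maxop R f x} \<le> ennreal C * (\<integral>\<^sup>+x. f x * ennreal (w x) \<partial>lebesgue)"
proof -
  let ?W = "density lebesgue (\<lambda>x. ennreal (w x))"
  note w = Ap_weightD_weight[OF A]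
  have [measurable]: "w \<in> borel_measurable lebesgue" by (rule weight_measurable[OF w])
  obtain D where D: "0 < D" "doubling_measure ?W D"
    using Ap_doubling[OF A order_refl] by metis
  interpret W: doubling_measure ?W D by (rule D)
  obtain K where K: "0 < K" "\<And>x r f. 0 < r \<Longrightarrow> f \<in> borel_measurable lebesgue \<Longrightarrow>
    enn_powr ((\<integral>\<^sup>+y\<in>ball x r. f y \<partial>lebesgue) / emeasure lebesgue (ball x r)) 1 * wmeas w (ball x r)
      \<le> ennreal K * (\<integral>\<^sup>+y\<in>ball x r. enn_powr (f y) 1 * ennreal (w y) \<partial>lebesgue)"
    using Ap_average_bound[OF A order_refl] by blast
  show ?thesis
  proof (rule that[of "D * K"])
    show "0 < D * K" using D K by simp
    fix R c :: real and f :: "'a \<Rightarrow> ennreal"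
    assume f [measurable]: "f \<in> borel_measurable lebesgue" and c: "0 < c"
    let ?F = "{b. 0 < snd b \<and> snd b \<le> R \<and>
      ennreal c < (\<integral>\<^sup>+z\<in>ball (fst b) (snd b). f z \<partial>lebesgue) / emeasure lebesgue (ball (fst b) (snd b))}"
    let ?U = "\<Union>b\<in>?F. ball (fst b) (snd b)"
    \<comment> \<open>Scaled so that the $A_1$ estimate on each ball of \<open>?F\<close> becomes
      the hypothesis of \<open>W.covering_bound\<close>.\<close>
    let ?h = "\<lambda>y. ennreal (K / c) * f y"
    have U: "?U \<in> sets lebesgue" by (rule leb.sets_open) auto
    have "emeasure ?W ?U \<le> ennreal D * (\<integral>\<^sup>+y. ?h y \<partial>?W)"
    proof (rule W.covering_bound)
      fix b assume b: "b \<in> ?F"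
      let ?B = "ball (fst b) (snd b)"
      have dens: "(\<integral>\<^sup>+y\<in>?B. ?h y \<partial>?W) = ennreal (K / c) * (\<integral>\<^sup>+y\<in>?B. f y * ennreal (w y) \<partial>lebesgue)"
      proof -
        have "(\<integral>\<^sup>+y\<in>?B. ?h y \<partial>?W) = (\<integral>\<^sup>+y. ennreal (w y) * (?h y * indicator ?B y) \<partial>lebesgue)"
          by (intro nn_integral_density) measurable
        also have "\<dots> = (\<integral>\<^sup>+y. ennreal (K / c) * (f y * ennreal (w y) * indicator ?B y) \<partial>lebesgue)"
          by (simp only: mult_ac)
        also have "\<dots> = ennreal (K / c) * (\<integral>\<^sup>+y\<in>?B. f y * ennreal (w y) \<partial>lebesgue)"
          by (intro nn_integral_cmult) measurable
        finally show ?thesis .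
      qed
      have "ennreal c * wmeas w ?B \<le> ennreal K * (\<integral>\<^sup>+y\<in>?B. f y * ennreal (w y) \<partial>lebesgue)"
      proof -
        have "ennreal c * wmeas w ?B \<le> ((\<integral>\<^sup>+y\<in>?B. f y \<partial>lebesgue) / emeasure lebesgue ?B) * wmeas w ?B"
          using b by (intro mult_right_mono) auto
        also have "\<dots> \<le> ennreal K * (\<integral>\<^sup>+y\<in>?B. f y * ennreal (w y) \<partial>lebesgue)"
          using K(2)[of "snd b" f "fst b"] b f by (simp only: enn_powr_1 mem_Collect_eq)
        finally show ?thesis .
      qed
      moreover have eqs: "ennreal (1 / c) * ennreal c = 1" "ennreal (1 / c) * ennreal K = ennreal (K / c)"
        using c K(1) by (simp_all flip: ennreal_mult)
      ultimately have "ennreal (1 / c) * (ennreal c * wmeas w ?B) \<le> ennreal (1 / c) * (ennreal K * (\<integral>\<^sup>+y\<in>?B. f y * ennreal (w y) \<partial>lebesgue))"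
        by (intro mult_left_mono) simp_all
      then show "emeasure ?W ?B \<le> (\<integral>\<^sup>+y\<in>?B. ?h y \<partial>?W)"
        unfolding dens mult.assoc[symmetric] eqs mult_1 by (simp only: wmeas_eq_emeasure_density[OF w] sets_lebesgue_ball)
    qed auto
    then have "ennreal c * wmeas w ?U \<le> ennreal c * (ennreal D * (\<integral>\<^sup>+y. ?h y \<partial>?W))"
      unfolding wmeas_eq_emeasure_density[OF w U] by (rule mult_left_mono) simp
    also have "(\<integral>\<^sup>+y. ?h y \<partial>?W) = ennreal (K / c) * (\<integral>\<^sup>+x. f x * ennreal (w x) \<partial>lebesgue)"
    proof -
      have "(\<integral>\<^sup>+y. ?h y \<partial>?W) = (\<integral>\<^sup>+y. ennreal (w y) * ?h y \<partial>lebesgue)"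
        by (intro nn_integral_density) measurable
      also have "\<dots> = (\<integral>\<^sup>+y. ennreal (K / c) * (f y * ennreal (w y)) \<partial>lebesgue)"
        by (simp only: mult_ac)
      also have "\<dots> = ennreal (K / c) * (\<integral>\<^sup>+y. f y * ennreal (w y) \<partial>lebesgue)"
        by (intro nn_integral_cmult) measurable
      finally show ?thesis .
    qed
    also have "ennreal c * (ennreal D * (ennreal (K / c) * (\<integral>\<^sup>+x. f x * ennreal (w x) \<partial>lebesgue)))
      = ennreal (D * K) * (\<integral>\<^sup>+x. f x * ennreal (w x) \<partial>lebesgue)"
    proof -
      have "ennreal c * ennreal D * ennreal (K / c) = ennreal (D * K)"
        using c K(1) D(1) by (simp flip: ennreal_mult)
      then show ?thesis by (simp only: mult.assoc[symmetric])
    qed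
    finally show "ennreal c * wmeas w {x. ennreal c < leb.maxop R f x} \<le> ennreal (D * K) * (\<integral>\<^sup>+x. f x * ennreal (w x) \<partial>lebesgue)"
      unfolding leb.maxop_superlevel .
  qed
qed

section \<open>Local estimates for the Hardy--Littlewood maximal function\<close>

text \<open>The integral on the right-hand side of the theorem; for \<open>p = 1\<close> the power
  \<open>1 / p\<close> is the identity, so both cases share it.\<close>

definition hardy_tail :: "real \<Rightarrow> ('a::euclidean_space \<Rightarrow> real) \<Rightarrow> ('a \<Rightarrow> real) \<Rightarrow> 'a \<Rightarrow> real \<Rightarrow> ennreal" where
  "hardy_tail p w f a r = (\<integral>\<^sup>+ s\<in>{r<..}. inverse (enn_powr (wmeas w (ball a s)) (1 / p))
     * Lpw_norm p w (ball a s) (\<lambda>y. ennreal \<bar>f y\<bar>) / ennreal s \<partial>lborel)"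

section \<open>Lower bounds for the tail integral\<close>

lemma Lpw_norm_mono:
  "0 \<le> p \<Longrightarrow> A \<subseteq> B \<Longrightarrow> Lpw_norm p w A g \<le> Lpw_norm p w B g"
  unfolding Lpw_norm_def
  by (intro enn_powr_mono nn_integral_mono) (auto simp: indicator_def)

lemma inverse_ennreal_antimono: "a \<le> b \<Longrightarrow> inverse b \<le> inverse (a::ennreal)"
  by (cases "a = 0"; cases a; cases b) (auto simp: inverse_ennreal top_unique intro!: ennreal_leI le_imp_inverse_le)

text \<open>Keep only \<open>s\<close> in \<open>{u<..2 * u}\<close>. There the inverse weight is
  smallest at \<open>2 * u\<close>, the norm is at least its value at \<open>u\<close>, and
  \<open>1 / s \<ge> 1 / (2 * u)\<close>. The interval has length \<open>u\<close>, hence the factor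
  2.\<close>

lemma hardy_tail_ge:
  assumes p: "0 < p" and u: "0 < u" "r \<le> u"
  shows "inverse (enn_powr (wmeas w (ball a (2 * u))) (1 / p)) * Lpw_norm p w (ball a u) (\<lambda>y. ennreal \<bar>f y\<bar>)
    \<le> 2 * hardy_tail p w f a r" (is "?i * ?n \<le> _")
proof -
  have "?i * ?n / ennreal (2 * u) * ennreal u = (\<integral>\<^sup>+s. ?i * ?n / ennreal (2 * u) * indicator {u<..2 * u} s \<partial>lborel)"
    using u by (subst nn_integral_cmult_indicator) auto
  also have "\<dots> \<le> hardy_tail p w f a r"
    unfolding hardy_tail_def
  proof (rule nn_integral_mono)
    fix s :: real
    show "?i * ?n / ennreal (2 * u) * indicator {u<..2 * u} s \<le>
      inverse (enn_powr (wmeas w (ball a s)) (1 / p)) * Lpw_norm p w (ball a s) (\<lambda>y. ennreal \<bar>f y\<bar>) / ennreal s * indicator {r<..} s"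
    proof (cases "s \<in> {u<..2 * u}")
      case True
      have "?i \<le> inverse (enn_powr (wmeas w (ball a s)) (1 / p))"
        using True p by (intro inverse_ennreal_antimono enn_powr_mono wmeas_mono subset_ball) auto
      moreover have "?n \<le> Lpw_norm p w (ball a s) (\<lambda>y. ennreal \<bar>f y\<bar>)"
        using True p by (intro Lpw_norm_mono subset_ball) auto
      moreover have "inverse (ennreal (2 * u)) \<le> inverse (ennreal s)"
        using True by (intro inverse_ennreal_antimono ennreal_leI) auto
      ultimately have "?i * ?n / ennreal (2 * u) \<le> inverse (enn_powr (wmeas w (ball a s)) (1 / p)) * Lpw_norm p w (ball a s) (\<lambda>y. ennreal \<bar>f y\<bar>) / ennreal s"
        unfolding divide_ennreal_def by (intro mult_mono) auto
      then show ?thesis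
        using True u by simp
    qed simp
  qed
  finally have "2 * (?i * ?n / ennreal (2 * u) * ennreal u) \<le> 2 * hardy_tail p w f a r"
    by (rule mult_left_mono) simp
  moreover have "2 * (?i * ?n / ennreal (2 * u) * ennreal u) = ?i * ?n / ennreal (2 * u) * ennreal (2 * u)"
    using u by (simp add: ennreal_mult mult_ac)
  moreover have "\<dots> = ?i * ?n"
    using u by (intro ennreal_divide_mult_cancel) auto
  ultimately show ?thesis by simp
qed

lemma wmeas_ball_double:
  assumes w: "weight w" and "doubling_measure (density lebesgue (\<lambda>x. ennreal (w x))) D" and r: "0 < r"
  shows "wmeas w (ball x (2 * r)) \<le> ennreal D * wmeas w (ball x r)"
proof -
  interpret doubling_measure "density lebesgue (\<lambda>x. ennreal (w x))" D by fact
  have "wmeas w (ball x (2 * r)) \<le> wmeas w (ball x (5 * r))"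
    using r by (intro wmeas_mono subset_ball) auto
  also have "\<dots> \<le> ennreal D * wmeas w (ball x r)"
    using doubling[OF r, of x] by (simp add: wmeas_eq_emeasure_density[OF w])
  finally show ?thesis .
qed

lemma ennreal_le_inverse_multI:
  assumes "0 < v" "v < top" "a * v \<le> (b::ennreal)"
  shows "a \<le> b * inverse v"
proof -
  have "a = a * v / v"
    using assms by (simp add: ennreal_mult_divide_eq)
  also have "\<dots> \<le> b / v" by (intro divide_right_mono_ennreal assms)
  finally show ?thesis by (simp add: divide_ennreal_def)
qed

lemma ennreal_inverse_mult_leI:
  assumes "0 < v" "v < top" "inverse v * a \<le> (b::ennreal)"
  shows "a \<le> b * v"
proof -
  have "a = inverse v * a * v"
    using assms by (metis divide_ennreal_def ennreal_divide_mult_cancel mult.commute)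
  also have "\<dots> \<le> b * v" by (intro mult_right_mono assms) simp
  finally show ?thesis .
qed

text \<open>Replace \<open>ball x t\<close> by the larger \<open>ball a (2 * t)\<close>, whose
  volume is \<open>2 ^ DIM('a)\<close> times as big, bound the average there by the $A_p$ condition,
  and compare with the tail integral.\<close>

lemma Ap_large_ball_average:
  fixes w :: "'a::euclidean_space \<Rightarrow> real"
  assumes A: "Ap_weight p w" and p: "1 \<le> p"
  obtains C where "0 < C" "\<And>a r x t f. 0 < r \<Longrightarrow> r \<le> t \<Longrightarrow> x \<in> ball a r \<Longrightarrow> f \<in> borel_measurable lebesgue \<Longrightarrow>
    (\<integral>\<^sup>+y\<in>ball x t. ennreal \<bar>f y\<bar> \<partial>lebesgue) / emeasure lebesgue (ball x t) \<le> ennreal C * hardy_tail p w f a r"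
proof -
  note w = Ap_weightD_weight[OF A]
  obtain D where D: "0 < D" "doubling_measure (density lebesgue (\<lambda>x. ennreal (w x))) D"
    using Ap_doubling[OF A p] by metis
  obtain K where K: "0 < K" "\<And>x r f. 0 < r \<Longrightarrow> f \<in> borel_measurable lebesgue \<Longrightarrow>
    enn_powr ((\<integral>\<^sup>+y\<in>ball x r. f y \<partial>lebesgue) / emeasure lebesgue (ball x r)) p * wmeas w (ball x r)
      \<le> ennreal K * (\<integral>\<^sup>+y\<in>ball x r. enn_powr (f y) p * ennreal (w y) \<partial>lebesgue)"
    using Ap_average_bound[OF A p] by blast
  \<comment> \<open>\<open>?k\<close> is the volume ratio and \<open>?e\<close> collects the $A_p$
    and doubling constants after taking the root of order \<open>p\<close>; the remaining 2 in the
    final constant comes from \<open>hardy_tail_ge\<close>.\<close>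
  let ?k = "2 ^ DIM('a) :: real" and ?e = "(K * D) powr (1 / p)"
  show ?thesis
  proof (rule that[of "?k * (?e * 2)"])
    show "0 < ?k * (?e * 2)" using K D by simp
    fix a x :: 'a and r t :: real and f :: "'a \<Rightarrow> real"
    assume r: "0 < r" "r \<le> t" and x: "x \<in> ball a r" and f [measurable]: "f \<in> borel_measurable lebesgue"
    have t: "0 < t" using r by simp
    let ?f = "\<lambda>y. ennreal \<bar>f y\<bar>" and ?B = "ball a (2 * t)"
    let ?A = "(\<integral>\<^sup>+y\<in>?B. ?f y \<partial>lebesgue) / emeasure lebesgue ?B"
    let ?v = "enn_powr (wmeas w (ball a (2 * (2 * t)))) (1 / p)"
    have sub: "ball x t \<subseteq> ?B"
    proof
      fix z assume "z \<in> ball x t"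
      then show "z \<in> ?B" using x r dist_triangle[of a z x] by simp
    qed
    obtain m where m: "emeasure lebesgue (ball x t) = ennreal m" "0 < m"
      using emeasure_lebesgue_ball_finite[of x t] emeasure_lebesgue_ball_pos[OF t, of x]
      by (cases "emeasure lebesgue (ball x t)") auto
    have B: "emeasure lebesgue ?B = ennreal (?k * m)"
      using emeasure_lebesgue_ball_scale[of 2 t a x] t m by (simp add: ennreal_mult)
    have "ennreal ?k * inverse (ennreal (?k * m)) = ennreal (?k * inverse (?k * m))"
      using m by (subst inverse_ennreal) (simp_all add: ennreal_mult)
    also have "?k * inverse (?k * m) = inverse m" by simp
    also have "ennreal (inverse m) = inverse (ennreal m)"
      using m by (simp add: inverse_ennreal)
    finally have km: "ennreal ?k * inverse (ennreal (?k * m)) = inverse (ennreal m)" .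
    have kB: "ennreal ?k * ?A = (\<integral>\<^sup>+y\<in>?B. ?f y \<partial>lebesgue) / emeasure lebesgue (ball x t)"
      unfolding divide_ennreal_def B m(1) km[symmetric] by (simp only: mult_ac)
    have v: "0 < ?v" "?v < top"
      using wmeas_ball_pos[OF w, of "2 * (2 * t)" a] wmeas_ball_finite[OF w, of a "2 * (2 * t)"] t
      by (simp_all add: zero_less_iff_neq_zero)
    \<comment> \<open>Doubling passes to radius \<open>4 * t\<close>, because
      \<open>hardy_tail_ge\<close> with \<open>u = 2 * t\<close> carries the weight of the ball of
      radius \<open>2 * u\<close>.\<close>
    have "enn_powr ?A p * wmeas w (ball a (2 * (2 * t))) \<le> enn_powr ?A p * (ennreal D * wmeas w ?B)"
      using t by (intro mult_left_mono wmeas_ball_double[OF w D(2)]) auto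
    also have "\<dots> = ennreal D * (enn_powr ?A p * wmeas w ?B)" by (simp add: mult_ac)
    also have "\<dots> \<le> ennreal D * (ennreal K * (\<integral>\<^sup>+y\<in>?B. enn_powr (?f y) p * ennreal (w y) \<partial>lebesgue))"
      using t by (intro mult_left_mono K(2)) auto
    also have "\<dots> = ennreal (K * D) * (\<integral>\<^sup>+y\<in>?B. enn_powr (?f y) p * ennreal (w y) \<partial>lebesgue)"
      using K D by (simp add: ennreal_mult mult_ac)
    finally have "enn_powr (enn_powr ?A p * wmeas w (ball a (2 * (2 * t)))) (1 / p)
      \<le> enn_powr (ennreal (K * D) * (\<integral>\<^sup>+y\<in>?B. enn_powr (?f y) p * ennreal (w y) \<partial>lebesgue)) (1 / p)"
      using p by (intro enn_powr_mono) auto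
    then have "?A * ?v \<le> ennreal ?e * Lpw_norm p w ?B ?f"
      using p K D by (simp add: enn_powr_mult enn_powr_powr enn_powr_ennreal Lpw_norm_def)
    then have "?A \<le> ennreal ?e * Lpw_norm p w ?B ?f * inverse ?v"
      by (rule ennreal_le_inverse_multI[OF v])
    also have "\<dots> = ennreal ?e * (inverse ?v * Lpw_norm p w ?B ?f)" by (simp add: mult_ac)
    also have "\<dots> \<le> ennreal ?e * (2 * hardy_tail p w f a r)"
      using p r by (intro mult_left_mono hardy_tail_ge) auto
    finally have "ennreal ?k * ?A \<le> ennreal ?k * (ennreal ?e * (2 * hardy_tail p w f a r))"
      by (rule mult_left_mono) simp
    also have "\<dots> = ennreal (?k * (?e * 2)) * hardy_tail p w f a r"
    proof -
      have "ennreal (?k * (?e * 2)) = ennreal ?k * (ennreal ?e * 2)"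
        by (simp add: ennreal_mult)
      then show ?thesis by (simp only: mult.assoc)
    qed
    finally have *: "ennreal ?k * ?A \<le> ennreal (?k * (?e * 2)) * hardy_tail p w f a r" .
    have "(\<integral>\<^sup>+y\<in>ball x t. ?f y \<partial>lebesgue) \<le> (\<integral>\<^sup>+y\<in>?B. ?f y \<partial>lebesgue)"
      using sub by (intro nn_integral_mono) (auto simp: indicator_def)
    then have "(\<integral>\<^sup>+y\<in>ball x t. ?f y \<partial>lebesgue) / emeasure lebesgue (ball x t) \<le> ennreal ?k * ?A"
      unfolding kB by (rule divide_right_mono_ennreal)
    also note *
    finally show "(\<integral>\<^sup>+y\<in>ball x t. ?f y \<partial>lebesgue) / emeasure lebesgue (ball x t)
        \<le> ennreal (?k * (?e * 2)) * hardy_tail p w f a r" .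
  qed
qed

text \<open>For \<open>t < r\<close> the ball \<open>ball x t\<close> lies in
  \<open>ball a (2 * r)\<close>, so cutting \<open>f\<close> off there changes nothing and the
  truncated operator dominates; for \<open>t \<ge> r\<close> the bound \<open>T\<close> applies.
  Stating it with a maximum lets the weak estimate keep the same level.\<close>

lemma maximal_fun_le:
  fixes f :: "'a::euclidean_space \<Rightarrow> real"
  assumes r: "0 < r" and x: "x \<in> ball a r"
    and T: "\<And>t. r \<le> t \<Longrightarrow> (\<integral>\<^sup>+y\<in>ball x t. ennreal \<bar>f y\<bar> \<partial>lebesgue) / emeasure lebesgue (ball x t) \<le> T"
  shows "maximal_fun f x \<le> max (leb.maxop r (\<lambda>y. ennreal \<bar>f y\<bar> * indicator (ball a (2 * r)) y) x) T"
  unfolding maximal_fun_def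
proof (rule SUP_least)
  fix t :: real assume t: "t \<in> {0<..}"
  show "(\<integral>\<^sup>+y\<in>ball x t. ennreal \<bar>f y\<bar> \<partial>lebesgue) / emeasure lebesgue (ball x t)
    \<le> max (leb.maxop r (\<lambda>y. ennreal \<bar>f y\<bar> * indicator (ball a (2 * r)) y) x) T"
  proof (cases "r \<le> t")
    case True
    then show ?thesis using T by (simp add: le_max_iff_disj)
  next
    case False
    have "y \<in> ball a (2 * r)" if "y \<in> ball x t" for y
      using that x False dist_triangle[of a y x] by simp
    then have "(\<integral>\<^sup>+y\<in>ball x t. ennreal \<bar>f y\<bar> \<partial>lebesgue) = (\<integral>\<^sup>+y\<in>ball x t. ennreal \<bar>f y\<bar> * indicator (ball a (2 * r)) y \<partial>lebesgue)"
      by (intro nn_integral_cong) (auto simp: indicator_def)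
    then show ?thesis
      using leb.le_maxop[of t r x x "\<lambda>y. ennreal \<bar>f y\<bar> * indicator (ball a (2 * r)) y"] False t
      by (simp add: le_max_iff_disj)
  qed
qed

text \<open>Apply \<open>hardy_tail_ge\<close> with \<open>u = 2 * r\<close> and double twice, from
  radius \<open>4 * r\<close> down to \<open>r\<close>; this gives the factor \<open>D * D\<close>
  under the root.\<close>

lemma Lpw_norm_double_le:
  fixes w :: "'a::euclidean_space \<Rightarrow> real"
  assumes w: "weight w" and D: "0 \<le> D" "doubling_measure (density lebesgue (\<lambda>x. ennreal (w x))) D"
    and p: "0 < p" and r: "0 < r"
  shows "Lpw_norm p w (ball a (2 * r)) (\<lambda>y. ennreal \<bar>f y\<bar>)
    \<le> ennreal (2 * (D * D) powr (1 / p)) * (enn_powr (wmeas w (ball a r)) (1 / p) * hardy_tail p w f a r)"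
proof -
  let ?v = "enn_powr (wmeas w (ball a (2 * (2 * r)))) (1 / p)"
  have v: "0 < ?v" "?v < top"
    using wmeas_ball_pos[OF w, of "2 * (2 * r)" a] wmeas_ball_finite[OF w, of a "2 * (2 * r)"] r
    by (simp_all add: zero_less_iff_neq_zero)
  have "Lpw_norm p w (ball a (2 * r)) (\<lambda>y. ennreal \<bar>f y\<bar>) \<le> 2 * hardy_tail p w f a r * ?v"
    using hardy_tail_ge[OF p, of "2 * r" r w a f] r by (intro ennreal_inverse_mult_leI[OF v]) auto
  also have "\<dots> \<le> 2 * hardy_tail p w f a r * (ennreal ((D * D) powr (1 / p)) * enn_powr (wmeas w (ball a r)) (1 / p))"
  proof (rule mult_left_mono)
    have "?v \<le> enn_powr (ennreal D * (ennreal D * wmeas w (ball a r))) (1 / p)"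
    proof (rule enn_powr_mono)
      have "wmeas w (ball a (2 * (2 * r))) \<le> ennreal D * wmeas w (ball a (2 * r))"
        using r by (intro wmeas_ball_double[OF w D(2)]) simp
      also have "\<dots> \<le> ennreal D * (ennreal D * wmeas w (ball a r))"
        using r by (intro mult_left_mono wmeas_ball_double[OF w D(2)]) auto
      finally show "wmeas w (ball a (2 * (2 * r))) \<le> ennreal D * (ennreal D * wmeas w (ball a r))" .
    qed (use p in simp)
    also have "\<dots> = ennreal ((D * D) powr (1 / p)) * enn_powr (wmeas w (ball a r)) (1 / p)"
      using D(1) by (simp add: enn_powr_mult enn_powr_ennreal powr_mult ennreal_mult mult_ac)
    finally show "?v \<le> ennreal ((D * D) powr (1 / p)) * enn_powr (wmeas w (ball a r)) (1 / p)" .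
  qed simp
  also have "\<dots> = ennreal (2 * (D * D) powr (1 / p)) * (enn_powr (wmeas w (ball a r)) (1 / p) * hardy_tail p w f a r)"
    by (simp add: ennreal_mult mult_ac)
  finally show ?thesis .
qed

text \<open>Integrate p-th powers of the pointwise splitting. The truncated operator acts on
  \<open>f\<close> restricted to the doubled ball, where the weighted maximal theorem applies, while
  the large balls contribute a constant integrated over \<open>ball a r\<close>.\<close>

lemma maximal_fun_strong_type:
  fixes w :: "'a::euclidean_space \<Rightarrow> real"
  assumes A: "Ap_weight p w" and p: "1 < p"
  obtains C where "0 < C" "\<And>a r f. 0 < r \<Longrightarrow> f \<in> borel_measurable lebesgue \<Longrightarrow>
    Lpw_norm p w (ball a r) (maximal_fun f) \<le> ennreal C * (enn_powr (wmeas w (ball a r)) (1 / p) * hardy_tail p w f a r)"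
proof -
  have p1: "1 \<le> p" and p0: "0 < p" using p by auto
  note w = Ap_weightD_weight[OF A]
  have [measurable]: "w \<in> borel_measurable lebesgue" by (rule weight_measurable[OF w])
  obtain D where D: "0 < D" "doubling_measure (density lebesgue (\<lambda>x. ennreal (w x))) D"
    using Ap_doubling[OF A p1] by metis
  obtain L where L: "0 < L" "\<And>a r x t f. 0 < r \<Longrightarrow> r \<le> t \<Longrightarrow> x \<in> ball a r \<Longrightarrow> f \<in> borel_measurable lebesgue \<Longrightarrow>
    (\<integral>\<^sup>+y\<in>ball x t. ennreal \<bar>f y\<bar> \<partial>lebesgue) / emeasure lebesgue (ball x t) \<le> ennreal L * hardy_tail p w f a r"
    using Ap_large_ball_average[OF A p1] by blast
  obtain S where S: "0 < S" "\<And>R f. f \<in> borel_measurable lebesgue \<Longrightarrow>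
    (\<integral>\<^sup>+x. enn_powr (leb.maxop R f x) p * ennreal (w x) \<partial>lebesgue) \<le> ennreal S * (\<integral>\<^sup>+x. enn_powr (f x) p * ennreal (w x) \<partial>lebesgue)"
    using maxop_lebesgue_strong_type[OF A p] by blast
  let ?d = "2 * (D * D) powr (1 / p)"
  let ?C = "S * ?d powr p + L powr p"
  have C0: "0 < ?C" using S L D by (intro add_pos_pos mult_pos_pos) auto
  show ?thesis
  proof (rule that[of "?C powr (1 / p)"])
    show "0 < ?C powr (1 / p)" using C0 by simp
    fix a :: 'a and r :: real and f :: "'a \<Rightarrow> real"
    assume r: "0 < r" and f [measurable]: "f \<in> borel_measurable lebesgue"
    let ?B = "ball a r" and ?Q = "hardy_tail p w f a r"
    let ?X = "enn_powr (wmeas w ?B) (1 / p) * ?Q"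
    let ?f = "\<lambda>y. ennreal \<bar>f y\<bar> * indicator (ball a (2 * r)) y"
    let ?V = "leb.maxop r ?f"
    have V [measurable]: "?V \<in> borel_measurable lebesgue" by (rule leb.borel_measurable_maxop)
    \<comment> \<open>Both contributions are expressed through the p-th power of the target, so that
      their constants simply add.\<close>
    have X: "enn_powr ?X p = enn_powr ?Q p * wmeas w ?B"
      using p by (simp add: enn_powr_mult enn_powr_powr mult.commute)
    have local_part: "(\<integral>\<^sup>+x. enn_powr (?V x) p * ennreal (w x) \<partial>lebesgue) \<le> ennreal (S * ?d powr p) * enn_powr ?X p"
    proof -
      have "(\<integral>\<^sup>+x. enn_powr (?f x) p * ennreal (w x) \<partial>lebesgue)
        = (\<integral>\<^sup>+x\<in>ball a (2 * r). enn_powr (ennreal \<bar>f x\<bar>) p * ennreal (w x) \<partial>lebesgue)"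
        by (intro nn_integral_cong) (auto simp: indicator_def)
      also have "\<dots> = enn_powr (Lpw_norm p w (ball a (2 * r)) (\<lambda>y. ennreal \<bar>f y\<bar>)) p"
        using p by (simp add: Lpw_norm_def enn_powr_powr)
      also have "\<dots> \<le> enn_powr (ennreal ?d * ?X) p"
        using p D r by (intro enn_powr_mono Lpw_norm_double_le w) auto
      also have "\<dots> = ennreal (?d powr p) * enn_powr ?X p"
        by (subst enn_powr_mult, subst enn_powr_ennreal) simp_all
      finally have *: "(\<integral>\<^sup>+x. enn_powr (?f x) p * ennreal (w x) \<partial>lebesgue) \<le> ennreal (?d powr p) * enn_powr ?X p" .
      have "(\<integral>\<^sup>+x. enn_powr (?V x) p * ennreal (w x) \<partial>lebesgue) \<le> ennreal S * (\<integral>\<^sup>+x. enn_powr (?f x) p * ennreal (w x) \<partial>lebesgue)"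
        by (intro S(2)) measurable
      also have "\<dots> \<le> ennreal S * (ennreal (?d powr p) * enn_powr ?X p)"
        by (intro mult_left_mono *) simp
      also have "\<dots> = ennreal (S * ?d powr p) * enn_powr ?X p"
        using ennreal_mult[of S "?d powr p"] S(1) by (simp only: less_imp_le powr_ge_zero mult.assoc)
      finally show ?thesis .
    qed
    have "(\<integral>\<^sup>+x\<in>?B. enn_powr (maximal_fun f x) p * ennreal (w x) \<partial>lebesgue)
      \<le> (\<integral>\<^sup>+x. enn_powr (?V x) p * ennreal (w x) + enn_powr (ennreal L * ?Q) p * (ennreal (w x) * indicator ?B x) \<partial>lebesgue)"
    \<comment> \<open>\<open>maximal_fun f\<close> is compared with a measurable majorant by
      monotonicity alone; additivity of the integral is applied to the majorant only.\<close>
    proof (rule nn_integral_mono)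
      fix x
      show "enn_powr (maximal_fun f x) p * ennreal (w x) * indicator ?B x
        \<le> enn_powr (?V x) p * ennreal (w x) + enn_powr (ennreal L * ?Q) p * (ennreal (w x) * indicator ?B x)"
      proof (cases "x \<in> ?B")
        case True
        have "enn_powr (maximal_fun f x) p \<le> enn_powr (max (?V x) (ennreal L * ?Q)) p"
          using p r L(2) f True by (intro enn_powr_mono maximal_fun_le) auto
        also have "\<dots> \<le> enn_powr (?V x) p + enn_powr (ennreal L * ?Q) p"
          by (auto simp: max_def add_increasing add_increasing2)
        finally have "enn_powr (maximal_fun f x) p * ennreal (w x) \<le> (enn_powr (?V x) p + enn_powr (ennreal L * ?Q) p) * ennreal (w x)"
          by (rule mult_right_mono) simp
        then show ?thesis
          using True by (simp only: distrib_right indicator_simps mult_1_right)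
      qed simp
    qed
    also have "\<dots> = (\<integral>\<^sup>+x. enn_powr (?V x) p * ennreal (w x) \<partial>lebesgue) + enn_powr (ennreal L * ?Q) p * wmeas w ?B"
      unfolding wmeas_def by (subst nn_integral_add) (auto simp: nn_integral_cmult)
    also have "enn_powr (ennreal L * ?Q) p * wmeas w ?B = ennreal (L powr p) * enn_powr ?X p"
      using L(1) by (simp only: X enn_powr_mult[of "ennreal L"] enn_powr_ennreal less_imp_le mult.assoc)
    also have "(\<integral>\<^sup>+x. enn_powr (?V x) p * ennreal (w x) \<partial>lebesgue) + ennreal (L powr p) * enn_powr ?X p
      \<le> ennreal (S * ?d powr p) * enn_powr ?X p + ennreal (L powr p) * enn_powr ?X p"
      by (intro add_right_mono local_part)
    also have "\<dots> = ennreal ?C * enn_powr ?X p"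
      using S(1) by (simp add: ennreal_plus distrib_right)
    finally have "Lpw_norm p w ?B (maximal_fun f) \<le> enn_powr (ennreal ?C * enn_powr ?X p) (1 / p)"
      unfolding Lpw_norm_def using p by (intro enn_powr_mono) auto
    also have "\<dots> = ennreal (?C powr (1 / p)) * ?X"
    proof -
      have "enn_powr (enn_powr ?X p) (1 / p) = ?X"
        using p by (simp add: enn_powr_powr)
      then show ?thesis
        using less_imp_le[OF C0] by (simp only: enn_powr_mult[of "ennreal ?C"] enn_powr_ennreal)
    qed
    finally show "Lpw_norm p w ?B (maximal_fun f) \<le> ennreal (?C powr (1 / p)) * ?X" .
  qed
qed

text \<open>At each level \<open>c\<close>, either the large-ball bound already exceeds
  \<open>c\<close>, or only small balls can push the maximal function above \<open>c\<close>. The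
  two cases contribute \<open>L\<close> and \<open>S * ?d\<close> to the constant.\<close>

lemma maximal_fun_weak_type:
  fixes w :: "'a::euclidean_space \<Rightarrow> real"
  assumes A: "Ap_weight 1 w"
  obtains C where "0 < C" "\<And>a r f. 0 < r \<Longrightarrow> f \<in> borel_measurable lebesgue \<Longrightarrow>
    WLpw_norm 1 w (ball a r) (maximal_fun f) \<le> ennreal C * (wmeas w (ball a r) * hardy_tail 1 w f a r)"
proof -
  note w = Ap_weightD_weight[OF A]
  have [measurable]: "w \<in> borel_measurable lebesgue" by (rule weight_measurable[OF w])
  obtain D where D: "0 < D" "doubling_measure (density lebesgue (\<lambda>x. ennreal (w x))) D"
    using Ap_doubling[OF A order_refl] by metis
  obtain L where L: "0 < L" "\<And>a r x t f. 0 < r \<Longrightarrow> r \<le> t \<Longrightarrow> x \<in> ball a r \<Longrightarrow> f \<in> borel_measurable lebesgue \<Longrightarrow>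
    (\<integral>\<^sup>+y\<in>ball x t. ennreal \<bar>f y\<bar> \<partial>lebesgue) / emeasure lebesgue (ball x t) \<le> ennreal L * hardy_tail 1 w f a r"
    using Ap_large_ball_average[OF A order_refl] by blast
  obtain S where S: "0 < S" "\<And>R f c. f \<in> borel_measurable lebesgue \<Longrightarrow> 0 < c \<Longrightarrow>
    ennreal c * wmeas w {x. ennreal c < leb.maxop R f x} \<le> ennreal S * (\<integral>\<^sup>+x. f x * ennreal (w x) \<partial>lebesgue)"
    using maxop_lebesgue_weak_type[OF A] by blast
  let ?d = "2 * (D * D)"
  show ?thesis
  proof (rule that[of "S * ?d + L"])
    show "0 < S * ?d + L" using S L D by (intro add_pos_pos mult_pos_pos) auto
    fix a :: 'a and r :: real and f :: "'a \<Rightarrow> real"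
    assume r: "0 < r" and f [measurable]: "f \<in> borel_measurable lebesgue"
    let ?B = "ball a r" and ?Q = "hardy_tail 1 w f a r"
    let ?X = "wmeas w ?B * ?Q"
    let ?f = "\<lambda>y. ennreal \<bar>f y\<bar> * indicator (ball a (2 * r)) y"
    have const: "ennreal (S * ?d + L) * ?X = ennreal (S * ?d) * ?X + ennreal L * ?X"
      using S L D by (simp add: ennreal_plus distrib_right)
    show "WLpw_norm 1 w ?B (maximal_fun f) \<le> ennreal (S * ?d + L) * ?X"
      unfolding WLpw_norm_def
    proof (rule SUP_least)
      fix c :: real assume c: "c \<in> {0<..}"
      let ?E = "{x \<in> ?B. ennreal c < maximal_fun f x}"
      have "ennreal c * wmeas w ?E \<le> ennreal (S * ?d + L) * ?X"
      proof (cases "ennreal c < ennreal L * ?Q")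
        case True
        \<comment> \<open>At such low levels the trivial inclusion of \<open>?E\<close> in
          \<open>?B\<close> suffices.\<close>
        have "ennreal c * wmeas w ?E \<le> ennreal L * ?Q * wmeas w ?B"
          using True by (intro mult_mono wmeas_mono) auto
        then show ?thesis
          unfolding const by (simp add: add_increasing mult_ac)
      next
        case False
        \<comment> \<open>A maximum exceeds \<open>c\<close> only through a term that does, and the
          large-ball term does not, so no level is lost.\<close>
        have "?E \<subseteq> {x. ennreal c < leb.maxop r ?f x}"
        proof safe
          fix x assume x: "x \<in> ?B" "ennreal c < maximal_fun f x"
          have "maximal_fun f x \<le> max (leb.maxop r ?f x) (ennreal L * ?Q)"
            using r x L(2) f by (intro maximal_fun_le) auto
          then show "ennreal c < leb.maxop r ?f x"
            using x False by (auto simp: le_max_iff_disj)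
        qed
        then have "ennreal c * wmeas w ?E \<le> ennreal c * wmeas w {x. ennreal c < leb.maxop r ?f x}"
          by (intro mult_left_mono wmeas_mono) auto
        also have "\<dots> \<le> ennreal S * (\<integral>\<^sup>+x. ?f x * ennreal (w x) \<partial>lebesgue)"
          using c by (intro S) auto
        also have "(\<integral>\<^sup>+x. ?f x * ennreal (w x) \<partial>lebesgue) = Lpw_norm 1 w (ball a (2 * r)) (\<lambda>y. ennreal \<bar>f y\<bar>)"
          unfolding Lpw_norm_def by (simp add: mult_ac)
        also have "ennreal S * \<dots> \<le> ennreal S * (ennreal ?d * ?X)"
          using Lpw_norm_double_le[OF w _ D(2), of 1 r a f] D r by (intro mult_left_mono) auto
        also have "\<dots> \<le> ennreal (S * ?d + L) * ?X"
          unfolding const using S D by (simp add: ennreal_mult mult.assoc add_increasing2)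
        finally show ?thesis .
      qed
      then show "ennreal c * enn_powr (wmeas w ?E) (1 / 1) \<le> ennreal (S * ?d + L) * ?X"
        by simp
    qed
  qed
qed

theorem theorem3p4:
  fixes w :: "'a::euclidean_space \<Rightarrow> real" and p :: real
  assumes "1 \<le> p" and "Ap_weight p w"
  shows "\<exists>C1>0. \<exists>C2>0. \<forall>(a::'a) (r::real). r > 0 \<longrightarrow>
    ((1 < p \<longrightarrow> (\<forall>f \<in> Lpw_loc p w.
        Lpw_norm p w (ball a r) (maximal_fun f)
          \<le> ennreal C1 * enn_powr (wmeas w (ball a r)) (1 / p) *
             (\<integral>\<^sup>+ s\<in>{r<..}. inverse (enn_powr (wmeas w (ball a s)) (1 / p))
                * Lpw_norm p w (ball a s) (\<lambda>y. ennreal \<bar>f y\<bar>) / ennreal s \<partial>lborel)))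
     \<and> (p = 1 \<longrightarrow> (\<forall>f \<in> Lpw_loc 1 w.
        WLpw_norm 1 w (ball a r) (maximal_fun f)
          \<le> ennreal C2 * wmeas w (ball a r) *
             (\<integral>\<^sup>+ s\<in>{r<..}. inverse (wmeas w (ball a s))
                * Lpw_norm 1 w (ball a s) (\<lambda>y. ennreal \<bar>f y\<bar>) / ennreal s \<partial>lborel))))"
proof (cases "p = 1")
  case True
  with assms have A: "Ap_weight 1 w" by simp
  obtain C where "0 < C" "\<And>a r f. 0 < r \<Longrightarrow> f \<in> borel_measurable lebesgue \<Longrightarrow>
    WLpw_norm 1 w (ball a r) (maximal_fun f) \<le> ennreal C * (wmeas w (ball a r) * hardy_tail 1 w f a r)"
    using maximal_fun_weak_type[OF A] by blast
  \<comment> \<open>\<open>C1 = 1\<close> is a placeholder: with \<open>p = 1\<close> the strong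
    estimate is vacuous. In the other case \<open>C2\<close> is chosen in the same way.\<close>
  then show ?thesis
    using True by (intro exI[of _ 1] exI[of _ C] conjI) (auto simp: hardy_tail_def Lpw_loc_def mult.assoc)
next
  case False
  with assms have p: "1 < p" by simp
  obtain C where "0 < C" "\<And>a r f. 0 < r \<Longrightarrow> f \<in> borel_measurable lebesgue \<Longrightarrow>
    Lpw_norm p w (ball a r) (maximal_fun f) \<le> ennreal C * (enn_powr (wmeas w (ball a r)) (1 / p) * hardy_tail p w f a r)"
    using maximal_fun_strong_type[OF assms(2) p] by blast
  then show ?thesis
    using p by (intro exI[of _ C] exI[of _ 1] conjI) (auto simp: hardy_tail_def Lpw_loc_def mult.assoc)
qed

end
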